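(* Let $b\ge 1$ be an integer and let $c>c_{b+2}$ be a constant. Let $G\sim\mathcal{G}(n,c/n)$. Then there is a constant $\varepsilon>0$ such that with high probability $s_b^*(G)\ge\varepsilon n$, i.e. $s_b^*(G)=\Omega(n)$; that is, Maker has a strategy in the $(1:b)$ component game on $G$ guaranteeing a connected component of linear size in her graph. This holds regardless of which player moves first.
   Context: $\mathcal{G}(n,p)$ is the binomial random graph on $n$ labelled vertices where each of the $\binom n2$ possible edges is present independently with probability $p$; "with high probability" means with probability tending to $1$ as $n\to\infty$. The $(1:b)$ component game on a graph $G$: two players, Maker and Breaker, alternately claim previously unclaimed edges of $G$; on each of her moves Maker claims one edge, on each of his moves Breaker claims $b$ edges (or all remaining ones if fewer than $b$ remain); the game ends when all edges are claimed. $s_b^*(G)$ denotes the largest $s$ such that Maker has a strategy guaranteeing that, at the end of the game, her graph contains a connected component with at least $s$ vertices, whatever Breaker does. For an integer $k\ge 3$ and $c>0$, let $\beta(c)$ be the largest $x\in[0,1]$ satisfying $x=\Pr[\mathrm{Poisson}(cx)\ge k-1]$, and define $c_k=\inf\{c>0:\beta(c)>0\}$ (the threshold constant for the appearance of a nonempty $k$-core in $\mathcal{G}(n,c/n)$). *)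

theory Defs
  imports "HOL-Probability.Probability"
begin

section \<open>Random graphs\<close>

text \<open>Simple graphs are given by a vertex set and a set of edges, each edge being a two-element set
  of vertices.\<close>

definition all_edges :: "'v set \<Rightarrow> 'v set set" where
  "all_edges V = {e. e \<subseteq> V \<and> card e = 2}"

text \<open>The edge set of the binomial random graph on the vertex set \<open>{1..n}\<close>. As \<^const>\<open>bernoulli_pmf\<close>
  truncates its parameter to the unit interval, a value \<open>p > 1\<close> (as \<open>p = c / n\<close> for small \<open>n\<close>) yields
  the complete graph.\<close>

definition gnp :: "nat \<Rightarrow> real \<Rightarrow> nat set set pmf" where
  "gnp n p = map_pmf (\<lambda>f. {e \<in> all_edges {1..n}. f e})
     (Pi_pmf (all_edges {1..n}) False (\<lambda>_. bernoulli_pmf p))"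

definition component_of :: "'v set set \<Rightarrow> 'v \<Rightarrow> 'v set" where
  "component_of E v = {(x, y). {x, y} \<in> E}\<^sup>* `` {v}"

section \<open>The component game\<close>

datatype player = Maker | Breaker

text \<open>A history lists the moves made so far, the oldest one first. Each move consists of a player
  and the set of edges claimed in it.\<close>

type_synonym 'v history = "(player \<times> 'v set set) list"

definition claimed :: "player \<Rightarrow> 'v history \<Rightarrow> 'v set set" where
  "claimed P h = \<Union>{S. (P, S) \<in> set h}"

definition unclaimed :: "'v set set \<Rightarrow> 'v history \<Rightarrow> 'v set set" where
  "unclaimed E h = E - (claimed Maker h \<union> claimed Breaker h)"

fun opponent :: "player \<Rightarrow> player" where
  "opponent Maker = Breaker"
| "opponent Breaker = Maker"

definition to_move :: "player \<Rightarrow> 'v history \<Rightarrow> player" where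
  "to_move first h = (if even (length h) then first else opponent first)"

text \<open>A strategy of Maker names the edge she claims next, given the history. It has to name an
  unclaimed edge as long as there is one.\<close>

definition maker_strategy :: "'v set set \<Rightarrow> ('v history \<Rightarrow> 'v set) \<Rightarrow> bool" where
  "maker_strategy E \<sigma> \<longleftrightarrow> (\<forall>h. unclaimed E h \<noteq> {} \<longrightarrow> \<sigma> h \<in> unclaimed E h)"

text \<open>The histories that can arise in the \<open>(1:b)\<close> game on \<open>E\<close> when Maker follows \<open>\<sigma>\<close>.\<close>

inductive play :: "nat \<Rightarrow> player \<Rightarrow> 'v set set \<Rightarrow> ('v history \<Rightarrow> 'v set) \<Rightarrow> 'v history \<Rightarrow> bool"
  for b first E \<sigma> where
  start: "play b first E \<sigma> []"
| maker: "play b first E \<sigma> (h @ [(Maker, {\<sigma> h})])"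
    if "play b first E \<sigma> h" "unclaimed E h \<noteq> {}" "to_move first h = Maker"
| breaker: "play b first E \<sigma> (h @ [(Breaker, S)])"
    if "play b first E \<sigma> h" "unclaimed E h \<noteq> {}" "to_move first h = Breaker"
      "S \<subseteq> unclaimed E h" "card S = min b (card (unclaimed E h))"

definition maker_can_guarantee ::
    "nat \<Rightarrow> player \<Rightarrow> 'v set \<Rightarrow> 'v set set \<Rightarrow> nat \<Rightarrow> bool" where
  "maker_can_guarantee b first V E s \<longleftrightarrow>
     (\<exists>\<sigma>. maker_strategy E \<sigma> \<and>
       (\<forall>h. play b first E \<sigma> h \<and> unclaimed E h = {} \<longrightarrow>
          (\<exists>v\<in>V. card (component_of (claimed Maker h) v) \<ge> s)))"

definition s_star :: "nat \<Rightarrow> player \<Rightarrow> 'v set \<Rightarrow> 'v set set \<Rightarrow> nat" where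
  "s_star b first V E = (GREATEST s. maker_can_guarantee b first V E s)"

section \<open>The threshold for the appearance of the \<open>k\<close>-core\<close>

text \<open>\<^const>\<open>poisson_pmf\<close> is only specified for positive rates; the Poisson distribution with
  rate 0 is the point mass at 0.\<close>

definition poisson_dist :: "real \<Rightarrow> nat pmf" where
  "poisson_dist r = (if r = 0 then return_pmf 0 else poisson_pmf r)"

definition core_beta :: "nat \<Rightarrow> real \<Rightarrow> real" where
  "core_beta k c =
     (GREATEST x. x \<in> {0..1} \<and> x = measure_pmf.prob (poisson_dist (c * x)) {j. j \<ge> k - 1})"

definition core_threshold :: "nat \<Rightarrow> real" where
  "core_threshold k = Inf {c. c > 0 \<and> core_beta k c > 0}"

end

theory Submission
  imports Defs "HOL-Real_Asymp.Real_Asymp"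
begin

text \<open>Maker enlarges one component, claiming any free edge that leaves it inside a suitable vertex set \<open>K\<close>.
  If her component \<open>T\<close> has \<open>t\<close> vertices, Breaker owns at most \<open>b t\<close> edges, so she can go on as long as more
  than \<open>b t\<close> edges of \<open>G[K]\<close> leave \<open>T\<close>. Sets of \<open>t \<le> \<epsilon> n\<close> vertices span at most \<open>(1 + 1 / s) t\<close> edges,
  hence it suffices that the degrees in \<open>T\<close> exceed \<open>b + 2\<close> by a total of a constant times \<open>t\<close>. This holds if
  the components of the subgraph of vertices of degree exactly \<open>b + 2\<close> (the low vertices) have bounded size.

  Instead of a core with this property we use the sets obtained by finitely many rounds of peeling, where a
  round removes the vertices of degree below \<open>b + 2\<close> and those in large low components. By the
  pigeonhole principle some round removes only few vertices; a maximality argument based on sparsity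
  shows that these do little damage. The peeled sets are large, uniformly in the number of rounds: a
  branching recursion for vertices with many good children, labelled so as to bound low paths,
  has a fixed point as soon as \<open>c\<close> is above the threshold, since at the maximum of \<open>f x - x\<close>, where \<open>f\<close> is the
  recursion for the core, the low vertices are subcritical. In the recursion \<open>v\<close> is deleted before its
  neighbours are examined, which makes them independent of the neighbourhood of \<open>v\<close>, also for several \<open>v\<close>
  at a time; moments of high order then give concentration without any local limit theory.\<close>

section \<open>Good vertices and peeling\<close>

text \<open>Why \<open>b + 2\<close>: the degrees of \<open>t\<close> vertices sum to twice the
  inner edges plus the boundary, and a small set has hardly more than \<open>t\<close> inner edges,
  which use up 2 per vertex. So the boundary is about \<open>b t\<close>, which Breaker can claim.
  Minimum degree \<open>b + 2\<close> alone leaves nothing to pay for the error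
  \<open>2 t / s\<close> from sparsity; the surplus over \<open>b + 2\<close> must beat it. Hence
  the bound on low components is fixed before \<open>s\<close>, and \<open>s\<close> before
  \<open>\<epsilon>\<close>.

  Peeling cannot be run to its end: the recursion is controlled only for a depth that stays fixed as
  \<open>n\<close> grows, and this covers boundedly many rounds. The number \<open>D\<close> of
  rounds therefore depends only on \<open>s\<close>, \<open>\<epsilon>\<close> and the density
  \<open>z\<close> of roots. The vertices lost in the cheapest round cannot simply be deleted, since
  that would start another round; the maximality argument absorbs them instead.

  Parameters are chosen in the order \<open>x\<close> and \<open>\<delta>\<close>, \<open>L\<close>,
  \<open>z\<close>, \<open>s\<close>, \<open>\<epsilon>\<close>, \<open>D\<close>. In the recursion
  \<open>a\<close> is \<open>b + 1\<close>: the parent supplies the remaining neighbour.\<close>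

definition nbrs :: "'v set set \<Rightarrow> 'v \<Rightarrow> 'v set" where
  "nbrs E v = {u. {u, v} \<in> E}"

text \<open>Read \<open>S\<close> as the good children and \<open>M\<close> as those with a smaller
  label. When \<open>M\<close> lies in \<open>S\<close>, a vertex with exactly \<open>a\<close>
  children in \<open>S\<close> passes only if all of them lie in \<open>M\<close>; a surplus child
  lifts this restriction.\<close>

definition sat :: "nat \<Rightarrow> 'v set \<Rightarrow> 'v set \<Rightarrow> 'v set \<Rightarrow> bool" where
  "sat a S M N \<longleftrightarrow> a < card (N \<inter> S) \<or> a \<le> card (N \<inter> M)"

text \<open>Levels \<open>h\<close> of a branching recursion. The label \<open>j\<close> bounds the length of descending paths through vertices with
  exactly \<open>a\<close> good children, and \<open>L\<close> is the largest admissible label.\<close>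

fun good :: "'v set set \<Rightarrow> nat \<Rightarrow> nat \<Rightarrow> nat \<Rightarrow> nat \<Rightarrow> 'v \<Rightarrow> 'v set \<Rightarrow> bool" where
  "good E a L 0 j v W = True"
| "good E a L (Suc h) j v W =
     sat a {u \<in> W - {v}. good E a L h L u (W - {v})}
           {u \<in> W - {v}. j > 0 \<and> good E a L h (j - 1) u (W - {v})} (nbrs E v)"

lemma nbrs_sym: "u \<in> nbrs E v \<longleftrightarrow> v \<in> nbrs E u"
  by (simp add: nbrs_def insert_commute)

lemma sat_mono:
  assumes "sat a S M N" "S \<subseteq> S'" "M \<subseteq> M'" "finite S'" "finite M'"
  shows "sat a S' M' N"
proof -
  have "card (N \<inter> S) \<le> card (N \<inter> S')" "card (N \<inter> M) \<le> card (N \<inter> M')"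
    using assms by (auto intro!: card_mono)
  then show ?thesis using assms(1) unfolding sat_def by linarith
qed

lemma good_mono:
  assumes "good E a L h j v W" "W \<subseteq> W'" "finite W'"
  shows "good E a L h j v W'"
  using assms
proof (induction h arbitrary: j v W W')
  case (Suc h)
  have "sat a {u \<in> W - {v}. good E a L h L u (W - {v})}
           {u \<in> W - {v}. j > 0 \<and> good E a L h (j - 1) u (W - {v})} (nbrs E v)"
    using Suc.prems(1) by simp
  then have "sat a {u \<in> W' - {v}. good E a L h L u (W' - {v})}
           {u \<in> W' - {v}. j > 0 \<and> good E a L h (j - 1) u (W' - {v})} (nbrs E v)"
    by (rule sat_mono) (use Suc.IH[where W="W - {v}" and W'="W' - {v}"] Suc.prems in auto)
  then show ?case by simp
qed simp

lemma good_mono_label: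
  assumes "good E a L h j v W" "j \<le> j'" "finite W"
  shows "good E a L h j' v W"
  using assms
proof (induction h arbitrary: j j' v W)
  case (Suc h)
  have "sat a {u \<in> W - {v}. good E a L h L u (W - {v})}
           {u \<in> W - {v}. j > 0 \<and> good E a L h (j - 1) u (W - {v})} (nbrs E v)"
    using Suc.prems(1) by simp
  then have "sat a {u \<in> W - {v}. good E a L h L u (W - {v})}
           {u \<in> W - {v}. j' > 0 \<and> good E a L h (j' - 1) u (W - {v})} (nbrs E v)"
    by (rule sat_mono) (use Suc.IH[where j="j - 1" and j'="j' - 1" and W="W - {v}"] Suc.prems in auto)
  then show ?case by simp
qed simp

text \<open>This locality lets the edges inside \<open>W\<close> be revealed while those leaving
  \<open>W\<close> stay independent.\<close>

lemma good_cong: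
  assumes "\<And>e. e \<subseteq> W \<Longrightarrow> e \<in> E \<longleftrightarrow> e \<in> E'" "v \<in> W"
  shows "good E a L h j v W \<longleftrightarrow> good E' a L h j v W"
  using assms
proof (induction h arbitrary: j v W)
  case (Suc h)
  have IH: "good E a L h i u (W - {v}) \<longleftrightarrow> good E' a L h i u (W - {v})" if "u \<in> W - {v}" for i u
    by (rule Suc.IH) (use Suc.prems that in auto)
  have "nbrs E v \<inter> {u \<in> W - {v}. Q u} = nbrs E' v \<inter> {u \<in> W - {v}. Q u}" for Q
    using Suc.prems by (auto simp: nbrs_def)
  moreover have "{u \<in> W - {v}. good E a L h L u (W - {v})} = {u \<in> W - {v}. good E' a L h L u (W - {v})}"
    "{u \<in> W - {v}. j > 0 \<and> good E a L h (j - 1) u (W - {v})}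
       = {u \<in> W - {v}. j > 0 \<and> good E' a L h (j - 1) u (W - {v})}"
    using IH by auto
  ultimately show ?case by (simp add: sat_def)
qed simp

section \<open>Degrees, low components and rounds of peeling\<close>

definition deg :: "'v set set \<Rightarrow> 'v set \<Rightarrow> 'v \<Rightarrow> nat" where
  "deg E A v = card (nbrs E v \<inter> A)"

definition low_rel :: "'v set set \<Rightarrow> nat \<Rightarrow> 'v set \<Rightarrow> ('v \<times> 'v) set" where
  "low_rel E k A = {(x, y). x \<in> A \<and> y \<in> A \<and> {x, y} \<in> E \<and> deg E A x = k \<and> deg E A y = k}"

text \<open>The closure is reflexive: a vertex of degree other than \<open>k\<close> has only itself
  in its component.\<close>

definition low_comp :: "'v set set \<Rightarrow> nat \<Rightarrow> 'v set \<Rightarrow> 'v \<Rightarrow> 'v set" where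
  "low_comp E k A v = (low_rel E k A)\<^sup>* `` {v}"

fun peel :: "'v set set \<Rightarrow> nat \<Rightarrow> nat \<Rightarrow> 'v set \<Rightarrow> nat \<Rightarrow> 'v set" where
  "peel E k M V 0 = V"
| "peel E k M V (Suc m) = {v \<in> peel E k M V m.
     deg E (peel E k M V m) v \<ge> k \<and> card (low_comp E k (peel E k M V m) v) \<le> M}"

lemma low_comp_subset:
  assumes "v \<in> Y" "\<And>x y. x \<in> Y \<Longrightarrow> (x, y) \<in> low_rel E k A \<Longrightarrow> y \<in> Y"
  shows "low_comp E k A v \<subseteq> Y"
proof
  fix w assume "w \<in> low_comp E k A v"
  then have "(v, w) \<in> (low_rel E k A)\<^sup>*" by (simp add: low_comp_def)
  then show "w \<in> Y" by (induction rule: rtrancl_induct) (use assms in auto)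
qed

lemma deg_mono: "A \<subseteq> A' \<Longrightarrow> finite A' \<Longrightarrow> deg E A v \<le> deg E A' v"
  unfolding deg_def by (intro card_mono) auto

section \<open>Explored vertices survive peeling\<close>

text \<open>The vertices visited by the recursion \<^const>\<open>good\<close> started at a root \<open>r\<close>: \<open>p\<close> is the vertex
  from which \<open>v\<close> was reached, \<open>W\<close> the set of vertices still available, and \<open>h\<close> the number of levels
  that remain to be explored.\<close>

inductive wit for E :: "'v set set" and a L h0 :: nat and V :: "'v set" and r :: 'v where
  wit_root: "wit E a L h0 V r h0 u r (V - {r})"
    if "u \<in> V - {r}" "u \<in> nbrs E r" "good E a L h0 L u (V - {r})"
| wit_step: "wit E a L h0 V r h u v (W - {v})"
    if "wit E a L h0 V r (Suc h) v p W" "u \<in> W - {v}" "u \<in> nbrs E v" "good E a L h L u (W - {v})"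

definition wset :: "'v set set \<Rightarrow> nat \<Rightarrow> nat \<Rightarrow> nat \<Rightarrow> 'v set \<Rightarrow> 'v \<Rightarrow> nat \<Rightarrow> 'v set" where
  "wset E a L h0 V r h = insert r {v. \<exists>h'\<ge>h. \<exists>p W. wit E a L h0 V r h' v p W}"

text \<open>With \<open>a + 2\<close> good children the root is itself high, so it ends low paths
  from above. Branches of the exploration may share vertices: only the parent and the children of
  each visited vertex matter, so no local tree structure of the graph is assumed.\<close>

locale witness =
  fixes E :: "'v set set" and a L h0 :: nat and V :: "'v set" and r :: 'v
  assumes finV: "finite V" and rV: "r \<in> V" and a1: "a \<ge> 1"
    and root: "card (nbrs E r \<inter> {u \<in> V - {r}. good E a L h0 L u (V - {r})}) \<ge> a + 2"
begin

abbreviation "wt \<equiv> wit E a L h0 V r"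
abbreviation "X \<equiv> wset E a L h0 V r"

lemma X_anti: "h \<le> h' \<Longrightarrow> X h' \<subseteq> X h"
  unfolding wset_def by (auto intro: order_trans)

lemma wit_facts:
  assumes "wt h v p W"
  shows "v \<in> W \<and> p \<notin> W \<and> W \<subseteq> V \<and> v \<in> nbrs E p \<and> good E a L h L v W \<and> p \<in> V \<and> h \<le> h0 \<and> p \<in> X h"
  using assms
proof (induction rule: wit.induct)
  case (wit_root u)
  then show ?case using rV by (auto simp: wset_def)
next
  case (wit_step h v p W u)
  have "v \<in> X h" using wit_step(1) unfolding wset_def by (auto intro!: exI[of _ "Suc h"])
  then show ?case using wit_step by auto
qed

lemma X_sub: "X h \<subseteq> V"
proof
  fix v assume "v \<in> X h"
  then consider "v = r" | h' p W where "wt h' v p W" by (auto simp: wset_def)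
  then show "v \<in> V"
  proof cases
    case 2
    then show ?thesis using wit_facts[OF 2] by auto
  qed (simp add: rV)
qed

lemma child_in_X:
  assumes "wt (Suc h) v p W" "u \<in> nbrs E v \<inter> {u \<in> W - {v}. good E a L h L u (W - {v})}" "g \<le> h"
  shows "u \<in> X g"
  using wit_step[OF assms(1), of u] assms(2,3) unfolding wset_def by auto

lemma wit_children:
  assumes w: "wt (Suc h) v p W"
  shows "a \<le> card (nbrs E v \<inter> {u \<in> W - {v}. good E a L h L u (W - {v})})"
proof -
  have fW: "finite W" using wit_facts[OF w] finV finite_subset by blast
  have s: "sat a {u \<in> W - {v}. good E a L h L u (W - {v})}
      {u \<in> W - {v}. L > 0 \<and> good E a L h (L - 1) u (W - {v})} (nbrs E v)"
    using wit_facts[OF w] by simp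
  have "card (nbrs E v \<inter> {u \<in> W - {v}. L > 0 \<and> good E a L h (L - 1) u (W - {v})})
     \<le> card (nbrs E v \<inter> {u \<in> W - {v}. good E a L h L u (W - {v})})"
    using fW by (intro card_mono) (auto intro: good_mono_label[where j="L - 1"])
  with s show ?thesis unfolding sat_def by linarith
qed

text \<open>The parent, deleted before \<open>v\<close> is examined, is a further neighbour next to
  the \<open>a\<close> good children.\<close>

lemma wit_deg:
  assumes w: "wt (Suc h) v p W" and XA: "X h \<subseteq> A" and fA: "finite A"
  shows "a + 1 \<le> deg E A v"
proof -
  let ?C = "nbrs E v \<inter> {u \<in> W - {v}. good E a L h L u (W - {v})}"
  have f: "finite ?C" using wit_facts[OF w] finV by (auto intro: finite_subset[of _ V])
  have "insert p ?C \<subseteq> nbrs E v \<inter> A"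
    using child_in_X[OF w _ order_refl] wit_facts[OF w] X_anti[of h "Suc h"] XA nbrs_sym[of p E v] by auto
  moreover have "card (insert p ?C) = card ?C + 1" using f wit_facts[OF w] by auto
  ultimately show ?thesis unfolding deg_def
    using card_mono[of "nbrs E v \<inter> A" "insert p ?C"] fA wit_children[OF w] by auto
qed

lemma root_deg:
  assumes XA: "X h \<subseteq> A" and fA: "finite A" and h: "h \<le> h0"
  shows "a + 2 \<le> deg E A r"
proof -
  let ?C = "nbrs E r \<inter> {u \<in> V - {r}. good E a L h0 L u (V - {r})}"
  have "?C \<subseteq> X h" using wit_root[of _ V r E a L h0] h unfolding wset_def by auto
  then have "card ?C \<le> card (nbrs E r \<inter> A)" using XA fA by (intro card_mono) auto
  then show ?thesis using root unfolding deg_def by linarith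
qed

text \<open>Degree \<open>a + 1\<close> in \<open>A\<close> has room for the parent and
  \<open>a\<close> good children only. These are then all neighbours of \<open>v\<close> in
  \<open>A\<close>, and without a surplus child all of them must carry the label
  \<open>j - 1\<close>.\<close>

lemma low_children:
  assumes w: "wt (Suc h) v p W" and XA: "X h \<subseteq> A" and fA: "finite A"
    and lo: "deg E A v = a + 1" and gj: "good E a L (Suc h) j v W"
    and u: "u \<in> nbrs E v \<inter> A" "u \<noteq> p"
  shows "j > 0 \<and> wt h u v (W - {v}) \<and> good E a L h (j - 1) u (W - {v})"
proof -
  let ?S = "nbrs E v \<inter> {u \<in> W - {v}. good E a L h L u (W - {v})}"
  let ?M = "nbrs E v \<inter> {u \<in> W - {v}. j > 0 \<and> good E a L h (j - 1) u (W - {v})}"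
  note f = wit_facts[OF w]
  have fS: "finite ?S" and fM: "finite ?M" using f finV by (auto intro: finite_subset[of _ V])
  have S: "insert p ?S \<subseteq> nbrs E v \<inter> A"
    using child_in_X[OF w _ order_refl] f X_anti[of h "Suc h"] XA nbrs_sym[of p E v] by auto
  have "card (insert p ?S) = card ?S + 1" using fS f by auto
  then have cS: "card ?S \<le> a" using card_mono[OF _ S] fA lo unfolding deg_def by auto
  then have cM: "a \<le> card ?M" using gj by (simp add: sat_def)
  then have j: "j > 0" using a1 by (cases "j > 0") auto
  \<comment> \<open>\<open>j\<close> is arbitrary, so the labels \<open>j - 1\<close> and
    \<open>L\<close> may compare either way.\<close>
  show ?thesis
  proof (cases "j - 1 \<le> L")
    case True
    have fW: "finite (W - {v})" using f finV finite_subset by blast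
    have "?M \<subseteq> ?S" using good_mono_label[OF _ True fW] by blast
    then have "?M = ?S" using card_seteq[OF fS] cM cS by auto
    have c: "card (insert p ?S) = card (nbrs E v \<inter> A)"
      using \<open>card (insert p ?S) = card ?S + 1\<close> cM \<open>?M = ?S\<close> cS lo unfolding deg_def by auto
    then have "insert p ?S = nbrs E v \<inter> A" using card_subset_eq[OF _ S] fA by auto
    then have "u \<in> ?S" using u by auto
    then show ?thesis using j \<open>?M = ?S\<close> wit_step[OF w, of u] by blast
  next
    case False
    have fW: "finite (W - {v})" using f finV finite_subset by blast
    have SM: "?S \<subseteq> ?M" using good_mono_label[OF _ _ fW, of E a L h L _ "j - 1"] False j by auto
    have "a \<le> card ?S" using wit_children[OF w] .
    then have c: "card (insert p ?S) = card (nbrs E v \<inter> A)"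
      using \<open>card (insert p ?S) = card ?S + 1\<close> cS lo unfolding deg_def by auto
    then have "insert p ?S = nbrs E v \<inter> A" using card_subset_eq[OF _ S] fA by auto
    then have "u \<in> ?S" using u by auto
    then show ?thesis using j SM wit_step[OF w, of u] by blast
  qed
qed

text \<open>Each step down a low path costs one label and one level, so a low path from
  \<open>v\<close> makes at most \<open>j\<close> steps down; with at most \<open>a\<close> branches
  per vertex this gives the size bound. Only the edge from \<open>v\<close> up to \<open>p\<close>
  may lead out of \<open>Y\<close>.\<close>

lemma down_closed:
  assumes "wt h v p W" "good E a L h j v W" "g + j < h" "X g \<subseteq> A" "finite A"
  shows "\<exists>Y. v \<in> Y \<and> finite Y \<and> card Y \<le> (a + 1) ^ (j + 1) \<and>
    (\<forall>x\<in>Y. \<forall>y. (x, y) \<in> low_rel E (a + 1) A \<longrightarrow> y \<in> Y \<or> x = v \<and> y = p)"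
  using assms
proof (induction j arbitrary: h v p W)
  case 0
  then obtain h' where h: "h = Suc h'" "g \<le> h'" by (cases h) auto
  have XA: "X h' \<subseteq> A" using X_anti[OF h(2)] 0 by auto
  have "y = p" if "(v, y) \<in> low_rel E (a + 1) A" for y
    using low_children[OF 0(1)[unfolded h(1)] XA 0(5) _ 0(2)[unfolded h(1)], of y] that
    by (auto simp: low_rel_def nbrs_def insert_commute)
  then show ?case using a1 by (intro exI[of _ "{v}"]) auto
next
  case (Suc j)
  then obtain h' where h: "h = Suc h'" "g + j < h'" by (cases h) auto
  have XA: "X h' \<subseteq> A" using X_anti[of g h'] h Suc by auto
  show ?case
  proof (cases "deg E A v = a + 1")
    case False
    have "card {v} \<le> (a + 1) ^ (Suc j + 1)" using one_le_power[of "a + 1" "Suc j + 1"] by simp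
    moreover have "\<forall>y. (v, y) \<notin> low_rel E (a + 1) A" using False by (simp add: low_rel_def)
    ultimately show ?thesis by (intro exI[of _ "{v}"]) blast
  next
    case True
    let ?N = "nbrs E v \<inter> A - {p}"
    have ch: "wt h' u v (W - {v}) \<and> good E a L h' j u (W - {v})" if "u \<in> ?N" for u
      using low_children[OF Suc.prems(1)[unfolded h(1)] XA Suc.prems(5) True Suc.prems(2)[unfolded h(1)], of u]
        that by auto
    define P where "P u Y \<longleftrightarrow> u \<in> Y \<and> finite Y \<and> card Y \<le> (a + 1) ^ (j + 1) \<and>
      (\<forall>x\<in>Y. \<forall>y. (x, y) \<in> low_rel E (a + 1) A \<longrightarrow> y \<in> Y \<or> x = u \<and> y = v)" for u Y
    have "\<exists>Y. P u Y" if "u \<in> ?N" for u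
      unfolding P_def
      by (rule Suc.IH[OF conjunct1[OF ch[OF that]] conjunct2[OF ch[OF that]] h(2) Suc.prems(4,5)])
    then obtain Y where Y': "\<And>u. u \<in> ?N \<Longrightarrow> P u (Y u)" by metis
    have Y: "u \<in> Y u" "finite (Y u)" "card (Y u) \<le> (a + 1) ^ (j + 1)"
      "\<And>x y. x \<in> Y u \<Longrightarrow> (x, y) \<in> low_rel E (a + 1) A \<Longrightarrow> y \<in> Y u \<or> x = u \<and> y = v"
      if "u \<in> ?N" for u
      using Y'[OF that] unfolding P_def by blast+
    let ?Y = "insert v (\<Union>u\<in>?N. Y u)"
    have pA: "p \<in> nbrs E v \<inter> A"
      using wit_facts[OF Suc.prems(1)] X_anti[of h' h] h(1) XA nbrs_sym[of p E v] by auto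
    have cN: "card ?N \<le> a" using True pA Suc.prems(5) unfolding deg_def by simp
    have "card (\<Union>u\<in>?N. Y u) \<le> (\<Sum>u\<in>?N. card (Y u))" using Suc.prems(5) by (intro card_UN_le) auto
    also have "\<dots> \<le> (\<Sum>u\<in>?N. (a + 1) ^ (j + 1))" using Y by (intro sum_mono) auto
    also have "\<dots> \<le> a * (a + 1) ^ (j + 1)" using cN by simp
    finally have "card (\<Union>u\<in>?N. Y u) \<le> a * (a + 1) ^ (j + 1)" .
    moreover have "1 \<le> (a + 1) ^ (j + 1)" by (rule one_le_power) simp
    ultimately have "1 + card (\<Union>u\<in>?N. Y u) \<le> (a + 1) ^ (j + 1) + a * (a + 1) ^ (j + 1)" by linarith
    moreover have "finite (\<Union>u\<in>?N. Y u)" using Y(2) Suc.prems(5) by auto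
    then have "card ?Y \<le> 1 + card (\<Union>u\<in>?N. Y u)" by (simp add: card_insert_if)
    ultimately have "card ?Y \<le> (a + 1) ^ (Suc j + 1)" by simp
    moreover have "finite ?Y" using Y Suc.prems(5) by auto
    moreover have "\<forall>x\<in>?Y. \<forall>y. (x, y) \<in> low_rel E (a + 1) A \<longrightarrow> y \<in> ?Y \<or> x = v \<and> y = p"
    proof (intro ballI allI impI)
      fix x y assume x: "x \<in> ?Y" and xy: "(x, y) \<in> low_rel E (a + 1) A"
      show "y \<in> ?Y \<or> x = v \<and> y = p"
      proof (cases "x = v")
        case True
        have "y \<in> nbrs E v \<inter> A" using xy True by (auto simp: low_rel_def nbrs_def insert_commute)
        then show ?thesis using True Y[of y] by auto
      next
        case False
        then obtain u where "u \<in> ?N" "x \<in> Y u" using x by auto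
        then show ?thesis using Y[of u] xy by blast
      qed
    qed
    ultimately show ?thesis by (intro exI[of _ ?Y]) auto
  qed
qed

text \<open>From \<open>v\<close>, climb through parents as long as the edges are low. The climb
  stops below the root at the latest, the root being high; from its last vertex the component is
  found by descending with the full label \<open>L\<close>.\<close>

lemma up_closed:
  assumes "wt h v p W" "g + L < h" "X g \<subseteq> A" "finite A"
  shows "\<exists>Y. v \<in> Y \<and> finite Y \<and> card Y \<le> (a + 1) ^ (L + 1) \<and>
    (\<forall>x\<in>Y. \<forall>y. (x, y) \<in> low_rel E (a + 1) A \<longrightarrow> y \<in> Y)"
  using assms
proof (induction rule: wit.induct)
  case (wit_root u)
  have w: "wt h0 u r (V - {r})" by (rule wit.wit_root) (use wit_root in auto)
  have "a + 2 \<le> deg E A r" using root_deg[of g A] wit_root by auto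
  then have "(x, r) \<notin> low_rel E (a + 1) A" for x by (auto simp: low_rel_def)
  then show ?case using down_closed[OF w wit_root(3), of g A] wit_root by blast
next
  case (wit_step h v p W u)
  have w: "wt h u v (W - {v})" by (rule wit.wit_step) (use wit_step in auto)
  show ?case
  proof (cases "(u, v) \<in> low_rel E (a + 1) A")
    case True
    then have "(v, u) \<in> low_rel E (a + 1) A" by (auto simp: low_rel_def insert_commute)
    then show ?thesis using wit_step by force
  next
    case False
    then show ?thesis using down_closed[OF w wit_step(4), of g A] wit_step by blast
  qed
qed

text \<open>Each round gives up the lowest \<open>L + 2\<close> levels that are left. This leaves
  room for following low paths down and for their last vertices still to have their children in the
  set of the previous round.\<close>

lemma wset_peel:
  assumes "m * (L + 2) \<le> h0"
  shows "X (m * (L + 2)) \<subseteq> peel E (a + 1) ((a + 1) ^ (L + 1)) V m"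
  using assms
proof (induction m)
  case 0
  then show ?case using X_sub by simp
next
  case (Suc m)
  let ?A = "peel E (a + 1) ((a + 1) ^ (L + 1)) V m"
  let ?g = "m * (L + 2)"
  have XA: "X ?g \<subseteq> ?A" using Suc by simp
  have sub: "peel E (a + 1) ((a + 1) ^ (L + 1)) V i \<subseteq> V" for i by (induction i) auto
  then have fA: "finite ?A" using finV finite_subset by blast
  show ?case
  proof
    fix v assume v: "v \<in> X (Suc m * (L + 2))"
    have vA: "v \<in> ?A" using v X_anti[of ?g "Suc m * (L + 2)"] XA by auto
    show "v \<in> peel E (a + 1) ((a + 1) ^ (L + 1)) V (Suc m)"
    proof (cases "v = r")
      case True
      have d: "a + 2 \<le> deg E ?A v" using root_deg[OF XA fA] Suc.prems True by simp
      then have "low_comp E (a + 1) ?A v \<subseteq> {v}" by (intro low_comp_subset) (auto simp: low_rel_def)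
      then have "card (low_comp E (a + 1) ?A v) \<le> card {v}" by (intro card_mono) auto
      also have "\<dots> \<le> (a + 1) ^ (L + 1)" by (simp del: power_Suc)
      finally show ?thesis using d vA by simp
    next
      case False
      then obtain h p W where h: "h \<ge> Suc m * (L + 2)" and w: "wt h v p W"
        using v unfolding wset_def by auto
      obtain h' where h': "h = Suc h'" "?g \<le> h'" using h by (cases h) auto
      have d: "a + 1 \<le> deg E ?A v"
        using wit_deg[OF w[unfolded h'(1)] _ fA] X_anti[OF h'(2)] XA by auto
      have "?g + L < h" using h by simp
      then obtain Y where Y: "v \<in> Y" "finite Y" "card Y \<le> (a + 1) ^ (L + 1)"
        "\<forall>x\<in>Y. \<forall>y. (x, y) \<in> low_rel E (a + 1) ?A \<longrightarrow> y \<in> Y"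
        using up_closed[OF w _ XA fA] by blast
      have "low_comp E (a + 1) ?A v \<subseteq> Y" using Y by (intro low_comp_subset) auto
      then have "card (low_comp E (a + 1) ?A v) \<le> card Y" using Y by (intro card_mono) auto
      then show ?thesis using d vA Y by simp
    qed
  qed
qed

lemma root_in_peel:
  assumes "m * (L + 2) \<le> h0"
  defines "A \<equiv> peel E (a + 1) ((a + 1) ^ (L + 1)) V m"
  shows "r \<in> A" "a + 2 \<le> deg E A r"
proof -
  have XA: "X (m * (L + 2)) \<subseteq> A" using wset_peel assms by simp
  then show "r \<in> A" by (auto simp: wset_def)
  have "A \<subseteq> V" unfolding A_def by (induction m) auto
  then show "a + 2 \<le> deg E A r" using root_deg[OF XA _ assms(1)] finV finite_subset by blast
qed

end

section \<open>Expansion from sparsity\<close>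

definition edges_in :: "'v set set \<Rightarrow> 'v set \<Rightarrow> nat" where
  "edges_in E S = card {e \<in> E. e \<subseteq> S}"

definition boundary :: "'v set set \<Rightarrow> 'v set \<Rightarrow> 'v set \<Rightarrow> 'v set set" where
  "boundary E S T = {e \<in> E. \<exists>x\<in>S. \<exists>y\<in>T. e = {x, y}}"

definition conn_from :: "'v set set \<Rightarrow> 'v \<Rightarrow> 'v set \<Rightarrow> bool" where
  "conn_from E r T \<longleftrightarrow> (\<forall>x\<in>T. (r, x) \<in> {(u, v). u \<in> T \<and> v \<in> T \<and> {u, v} \<in> E}\<^sup>*)"

lemma card_boundary:
  assumes "finite S" "finite T" "S \<inter> T = {}"
  shows "card (boundary E S T) = (\<Sum>x\<in>S. deg E T x)"
proof -
  let ?P = "SIGMA x:S. nbrs E x \<inter> T"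
  have "boundary E S T = (\<lambda>(x, y). {x, y}) ` ?P"
    by (auto simp: boundary_def nbrs_def insert_commute image_iff)
  moreover have "inj_on (\<lambda>(x, y). {x, y}) ?P"
    using assms(3) by (auto simp: inj_on_def doubleton_eq_iff)
  ultimately have "card (boundary E S T) = card ?P" by (simp add: card_image)
  also have "\<dots> = (\<Sum>x\<in>S. deg E T x)" using assms by (simp add: deg_def)
  finally show ?thesis .
qed

lemma finite_edges:
  assumes "finite V" "E \<subseteq> all_edges V" shows "finite E"
proof -
  have "E \<subseteq> Pow V" using assms by (auto simp: all_edges_def)
  then show ?thesis using assms finite_subset by blast
qed

lemma not_nbr_self:
  assumes "E \<subseteq> all_edges V" shows "v \<notin> nbrs E v"
  using assms by (auto simp: nbrs_def all_edges_def)

lemma edges_in_disjoint: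
  assumes "finite E" "finite R" "finite T" "R \<inter> T = {}" "{} \<notin> E"
  shows "edges_in E R + edges_in E T + card (boundary E T R) \<le> edges_in E (R \<union> T)"
proof -
  have "card {e \<in> E. e \<subseteq> R} + card {e \<in> E. e \<subseteq> T} + card (boundary E T R)
      = card ({e \<in> E. e \<subseteq> R} \<union> {e \<in> E. e \<subseteq> T} \<union> boundary E T R)"
  proof -
    have 1: "{e \<in> E. e \<subseteq> R} \<inter> {e \<in> E. e \<subseteq> T} = {}"
    proof -
      have "e = {}" if "e \<subseteq> R" "e \<subseteq> T" for e using that assms(4) by blast
      then show ?thesis using assms(5) by blast
    qed
    have 2: "({e \<in> E. e \<subseteq> R} \<union> {e \<in> E. e \<subseteq> T}) \<inter> boundary E T R = {}"
      using assms(4) by (auto simp: boundary_def)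
    have "finite (boundary E T R)" using assms(1) by (auto simp: boundary_def)
    then show ?thesis using 1 2 assms(1) by (simp add: card_Un_disjoint)
  qed
  also have "\<dots> \<le> card {e \<in> E. e \<subseteq> R \<union> T}"
    using assms(1) by (intro card_mono) (auto simp: boundary_def)
  finally show ?thesis by (simp add: edges_in_def)
qed

lemma sum_deg_in:
  assumes "finite E" "E \<subseteq> all_edges V" "finite T"
  shows "(\<Sum>v\<in>T. deg E T v) = 2 * edges_in E T"
  using assms(3)
proof (induction rule: finite_induct)
  case empty
  have "{e \<in> E. e \<subseteq> {}} = {}" using assms(2) by (auto simp: all_edges_def)
  then show ?case by (simp add: edges_in_def)
next
  case (insert v T)
  have nv: "deg E (insert v T) v = deg E T v"
    using not_nbr_self[OF assms(2), of v] by (simp add: deg_def)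
  have "deg E (insert v T) u = deg E T u + (if u \<in> nbrs E v \<inter> T then 1 else 0)" if "u \<in> T" for u
    using insert nbrs_sym[of u E v] that by (auto simp: deg_def)
  then have "(\<Sum>u\<in>T. deg E (insert v T) u) = (\<Sum>u\<in>T. deg E T u) + (\<Sum>u\<in>T. if u \<in> nbrs E v \<inter> T then 1 else 0)"
    by (simp add: sum.distrib)
  also have "(\<Sum>u\<in>T. if u \<in> nbrs E v \<inter> T then 1 else 0) = deg E T v"
    using insert(1) by (simp add: sum.If_cases deg_def Int_def conj_commute)
  finally have 1: "(\<Sum>u\<in>insert v T. deg E (insert v T) u) = 2 * edges_in E T + 2 * deg E T v"
    using insert nv by simp
  have "{e \<in> E. e \<subseteq> insert v T} = {e \<in> E. e \<subseteq> T} \<union> (\<lambda>u. {u, v}) ` (nbrs E v \<inter> T)"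
  proof -
    have "e \<in> (\<lambda>u. {u, v}) ` (nbrs E v \<inter> T)" if "e \<in> E" "e \<subseteq> insert v T" "\<not> e \<subseteq> T" for e
    proof -
      have "card e = 2" "v \<in> e" using that assms(2) by (auto simp: all_edges_def)
      then obtain u where "e = {u, v}" "u \<noteq> v" by (auto simp: card_2_iff)
      then show ?thesis using that by (auto simp: nbrs_def)
    qed
    then show ?thesis by (auto simp: nbrs_def)
  qed
  moreover have "inj_on (\<lambda>u. {u, v}) (nbrs E v \<inter> T)" by (auto simp: inj_on_def doubleton_eq_iff)
  moreover have "{e \<in> E. e \<subseteq> T} \<inter> (\<lambda>u. {u, v}) ` (nbrs E v \<inter> T) = {}" using insert by auto
  ultimately have "edges_in E (insert v T) = edges_in E T + deg E T v"
    using assms(1) insert(1) by (simp add: edges_in_def card_Un_disjoint card_image deg_def)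
  then show ?case using 1 by simp
qed

text \<open>Each component of low vertices in \<open>T\<close> is attached to a vertex of larger degree in \<open>T\<close>, whose
  excess degree pays for it.\<close>

lemma excess_bound:
  assumes fA: "finite A" and TA: "T \<subseteq> A" and r: "r \<in> T" "k < deg E A r" and c: "conn_from E r T"
    and dk: "\<And>v. v \<in> T \<Longrightarrow> k \<le> deg E A v"
    and M: "\<And>v. v \<in> T \<Longrightarrow> card (low_comp E k A v) \<le> M"
  shows "card T \<le> (M * (k + 1) + 1) * (\<Sum>v\<in>T. deg E A v - k)"
proof -
  have fT: "finite T" using fA TA finite_subset by blast
  let ?H = "{v \<in> T. k < deg E A v}"
  let ?U = "\<Union>h\<in>?H. \<Union>w\<in>nbrs E h \<inter> T. low_comp E k A w"
  \<comment> \<open>Follow a walk from \<open>r\<close> inside \<open>T\<close>: a vertex is high,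
    or lies in the low component of a neighbour of some high vertex, and a step between low vertices
    stays in that component.\<close>
  have sub: "x \<in> ?H \<union> ?U" if "x \<in> T" for x
  proof -
    have "(r, x) \<in> {(u, v). u \<in> T \<and> v \<in> T \<and> {u, v} \<in> E}\<^sup>*" using c that by (auto simp: conn_from_def)
    then show ?thesis
    proof (induction rule: rtrancl_induct)
      case base then show ?case using r by auto
    next
      case (step y z)
      then have yz: "y \<in> T" "z \<in> T" "{y, z} \<in> E" by auto
      show ?case
      proof (cases "k < deg E A z")
        case True then show ?thesis using yz by auto
      next
        case zl: False
        show ?thesis
        proof (cases "k < deg E A y")
          case True
          then have "y \<in> ?H" "z \<in> nbrs E y \<inter> T" "z \<in> low_comp E k A z"
            using yz by (auto simp: nbrs_def insert_commute low_comp_def)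
          then show ?thesis by blast
        next
          case False
          then obtain h w where hw: "h \<in> ?H" "w \<in> nbrs E h \<inter> T" "y \<in> low_comp E k A w" using step.IH by auto
          have "(y, z) \<in> low_rel E k A" using yz zl False dk TA by (force simp: low_rel_def)
          then have "z \<in> low_comp E k A w" using hw(3) by (auto simp: low_comp_def)
          then show ?thesis using hw by blast
        qed
      qed
    qed
  qed
  have fl: "finite (low_comp E k A w)" if "w \<in> T" for w
  proof -
    have "low_comp E k A w \<subseteq> insert w A" by (intro low_comp_subset) (auto simp: low_rel_def)
    then show ?thesis using fA finite_subset by blast
  qed
  have "card ?U \<le> (\<Sum>h\<in>?H. card (\<Union>w\<in>nbrs E h \<inter> T. low_comp E k A w))"
    using fT by (intro card_UN_le) auto
  also have "\<dots> \<le> (\<Sum>h\<in>?H. M * (k + 1) * (deg E A h - k))"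
  proof (intro sum_mono)
    fix h assume h: "h \<in> ?H"
    have "card (\<Union>w\<in>nbrs E h \<inter> T. low_comp E k A w) \<le> (\<Sum>w\<in>nbrs E h \<inter> T. card (low_comp E k A w))"
      using fT by (intro card_UN_le) auto
    also have "\<dots> \<le> (\<Sum>w\<in>nbrs E h \<inter> T. M)" using M by (intro sum_mono) auto
    also have "\<dots> = deg E T h * M" by (simp add: deg_def)
    also have "\<dots> \<le> deg E A h * M" using deg_mono[OF TA fA] by simp
    also have "\<dots> \<le> ((k + 1) * (deg E A h - k)) * M"
    proof (intro mult_right_mono)
      obtain d where "deg E A h = k + 1 + d" using h less_iff_Suc_add[of k] by auto
      then show "deg E A h \<le> (k + 1) * (deg E A h - k)" by simp
    qed simp
    finally show "card (\<Union>w\<in>nbrs E h \<inter> T. low_comp E k A w) \<le> M * (k + 1) * (deg E A h - k)"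
      by (simp add: algebra_simps)
  qed
  also have "\<dots> = M * (k + 1) * (\<Sum>h\<in>?H. deg E A h - k)" by (simp add: sum_distrib_left)
  finally have U: "card ?U \<le> M * (k + 1) * (\<Sum>h\<in>?H. deg E A h - k)" .
  have H: "card ?H \<le> (\<Sum>h\<in>?H. deg E A h - k)"
  proof -
    have "card ?H = (\<Sum>h\<in>?H. 1)" by simp
    also have "\<dots> \<le> (\<Sum>h\<in>?H. deg E A h - k)" by (intro sum_mono) auto
    finally show ?thesis .
  qed
  have "finite ?U" using fl fT by auto
  moreover have "T \<subseteq> ?H \<union> ?U" using sub by (rule subsetI)
  ultimately have "card T \<le> card (?H \<union> ?U)" using fT by (intro card_mono) simp_all
  also have "\<dots> \<le> card ?H + card ?U" by (rule card_Un_le)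
  also have "\<dots> \<le> (M * (k + 1) + 1) * (\<Sum>h\<in>?H. deg E A h - k)" using U H by (simp add: algebra_simps)
  also have "\<dots> \<le> (M * (k + 1) + 1) * (\<Sum>v\<in>T. deg E A v - k)"
    using fT by (intro mult_left_mono sum_mono2) auto
  finally show ?thesis .
qed

text \<open>\<open>R\<close> is a largest set that contains \<open>B\<close> and whose edge density is too high compared to
  sparsity, up to the contribution of \<open>B\<close>; a set \<open>T\<close> with few boundary edges could be added to it.\<close>

lemma expanding_core:
  fixes E :: "'v set set"
  assumes fV: "finite V" and EV: "E \<subseteq> all_edges V" and AV: "A \<subseteq> V" and BA: "B \<subseteq> A"
    and dk: "\<And>v. v \<in> A - B \<Longrightarrow> b + 2 \<le> deg E A v"
    and M: "\<And>v. v \<in> A - B \<Longrightarrow> card (low_comp E (b + 2) A v) \<le> M"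
    and sparse: "\<And>S. S \<subseteq> V \<Longrightarrow> card S \<le> m \<Longrightarrow> s * edges_in E S \<le> (s + 1) * card S"
    and s: "s \<ge> 3 * (M * (b + 3) + 1)"
    and B: "(s + 2) * card B \<le> m div 2"
    and H: "(s + 2) * card B < card {v \<in> A. b + 2 < deg E A v}"
  shows "\<exists>K r. r \<in> K \<and> K \<subseteq> V \<and> (\<forall>T. T \<subseteq> K \<and> r \<in> T \<and> conn_from E r T \<and> card T \<le> m div 2 \<longrightarrow>
     b * card T < card (boundary E T (K - T)))"
proof -
  have fE: "finite E" by (rule finite_edges[OF fV EV])
  have fA: "finite A" using fV AV finite_subset by blast
  have fin: "finite S" if "S \<subseteq> A" for S using fA that finite_subset by blast
  have ne: "{} \<notin> E" using EV by (auto simp: all_edges_def)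
  \<comment> \<open>The weight \<open>s + 2\<close> exceeds the \<open>s + 1\<close> permitted by
    sparsity, so such a set has at most \<open>(s + 2) * card B\<close> vertices; the last term
    makes \<open>B\<close> itself qualify.\<close>
  define Q where "Q R \<longleftrightarrow> B \<subseteq> R \<and> R \<subseteq> A \<and> card R \<le> m \<and>
     (s + 2) * card R \<le> s * edges_in E R + (s + 2) * card B" for R
  have "card B \<le> (s + 2) * card B" by simp
  then have "card B \<le> m" using B by linarith
  then have QB: "Q B" using BA by (auto simp: Q_def)
  have "\<exists>R. Q R \<and> (\<forall>R'. Q R' \<longrightarrow> card R' \<le> card R)"
    using ex_has_greatest_nat[of Q B card "m + 1"] QB by (auto simp: Q_def)
  then obtain R where R: "Q R" and Rmax: "\<And>R'. Q R' \<Longrightarrow> card R' \<le> card R" by blast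
  have RA: "R \<subseteq> A" and BR: "B \<subseteq> R" and Rm: "card R \<le> m"
    and Re: "(s + 2) * card R \<le> s * edges_in E R + (s + 2) * card B" using R by (auto simp: Q_def)
  have "s * edges_in E R \<le> (s + 1) * card R" using sparse[of R] RA AV Rm by auto
  then have cR: "card R \<le> (s + 2) * card B" using Re by (simp add: algebra_simps)
  \<comment> \<open>By \<open>H\<close> there are more high vertices than \<open>R\<close> can hold;
    one outside \<open>R\<close> becomes Maker's starting vertex.\<close>
  have "\<not> {v \<in> A. b + 2 < deg E A v} \<subseteq> R"
  proof
    assume "{v \<in> A. b + 2 < deg E A v} \<subseteq> R"
    then have "card {v \<in> A. b + 2 < deg E A v} \<le> card R" by (intro card_mono fin[OF RA])
    then show False using H cR by linarith
  qed
  then obtain r where r: "r \<in> A - R" "b + 2 < deg E A r" by auto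
  have "b * card T < card (boundary E T (A - R - T))"
    if T: "T \<subseteq> A - R" "r \<in> T" "conn_from E r T" "card T \<le> m div 2" for T
  proof (rule ccontr)
    assume "\<not> ?thesis"
    then have viol: "card (boundary E T (A - R - T)) \<le> b * card T" by simp
    have TA: "T \<subseteq> A" and TR: "T \<inter> R = {}" using T by auto
    have fT: "finite T" and fR: "finite R" using fin TA RA by auto
    define \<psi> where "\<psi> = (\<Sum>v\<in>T. deg E A v - (b + 2))"
    have dT: "b + 2 \<le> deg E A v" if "v \<in> T" for v using dk that T BR by blast
    have psi: "card T \<le> (M * (b + 3) + 1) * \<psi>"
      using excess_bound[OF fA TA T(2) r(2) T(3) dT, of M] M T BR unfolding \<psi>_def
      by (auto simp: numeral_3_eq_3)
    have "deg E A v = deg E T v + deg E R v + deg E (A - R - T) v" for v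
    proof -
      have "nbrs E v \<inter> A = (nbrs E v \<inter> T) \<union> (nbrs E v \<inter> R) \<union> (nbrs E v \<inter> (A - R - T))"
        using TA RA by auto
      then show ?thesis unfolding deg_def using fT fR fA TR
        by (simp add: card_Un_disjoint Int_Un_distrib2 disjoint_iff)
    qed
    then have "(\<Sum>v\<in>T. deg E A v) = 2 * edges_in E T + card (boundary E T R) + card (boundary E T (A - R - T))"
      using card_boundary[OF fT fR TR] card_boundary[OF fT, of "A - R - T"] fA
        sum_deg_in[OF fE EV fT] by (simp add: sum.distrib)
    moreover have "(\<Sum>v\<in>T. deg E A v) = \<psi> + (b + 2) * card T"
    proof -
      have "(\<Sum>v\<in>T. deg E A v) = (\<Sum>v\<in>T. (deg E A v - (b + 2)) + (b + 2))"
        by (rule sum.cong[OF refl]) (metis dT le_add_diff_inverse2)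
      then show ?thesis by (simp only: sum.distrib \<psi>_def sum_constant) (simp add: algebra_simps)
    qed
    \<comment> \<open>The few edges to the rest of \<open>K\<close> cover \<open>b\<close> per
      vertex, so 2 per vertex and the surplus \<open>\<psi>\<close> remain for edges inside
      \<open>T\<close> and towards \<open>R\<close>.\<close>
    ultimately have e1: "\<psi> + 2 * card T \<le> 2 * edges_in E T + card (boundary E T R)"
      using viol by (simp add: algebra_simps)
    have e2: "s * edges_in E T \<le> (s + 1) * card T" using sparse[of T] TA AV T(4) by auto
    have e3: "3 * card T \<le> s * \<psi>"
    proof -
      have "3 * card T \<le> (3 * (M * (b + 3) + 1)) * \<psi>"
        using mult_left_mono[OF psi, of 3] by (simp only: mult.assoc)
      also have "\<dots> \<le> s * \<psi>" using s by (intro mult_right_mono) auto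
      finally show ?thesis .
    qed
    have e1': "s * \<psi> + 2 * (s * card T) \<le> 2 * (s * edges_in E T) + s * card (boundary E T R)"
      using mult_left_mono[OF e1, of s] by (simp add: algebra_simps)
    \<comment> \<open>The balance is \<open>2 * s + 3 - (s + 1) = s + 2\<close>, the rate that
      \<open>Q\<close> demands; this is the origin of the factor 3 in the hypothesis on
      \<open>s\<close>.\<close>
    have e4: "(s + 2) * card T \<le> s * edges_in E T + s * card (boundary E T R)"
      using e1' e2 e3 by (simp add: algebra_simps)
    have ein: "edges_in E R + edges_in E T + card (boundary E T R) \<le> edges_in E (R \<union> T)"
      using edges_in_disjoint[OF fE fR fT _ ne] TR by (simp add: Int_commute)
    have "s * edges_in E R + s * edges_in E T + s * card (boundary E T R) \<le> s * edges_in E (R \<union> T)"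
      using mult_left_mono[OF ein, of s] by (simp add: algebra_simps)
    moreover have cU: "card (R \<union> T) = card R + card T" using fR fT TR by (simp add: card_Un_disjoint Int_commute)
    ultimately have "(s + 2) * card (R \<union> T) \<le> s * edges_in E (R \<union> T) + (s + 2) * card B"
      using Re e4 by (simp add: algebra_simps)
    moreover have "card (R \<union> T) \<le> m" using cU cR B T(4) by linarith
    ultimately have "Q (R \<union> T)" using BR RA TA by (auto simp: Q_def)
    then have "card T = 0" using Rmax cU by fastforce
    then show False using T(2) fT by auto
  qed
  moreover have "A - R \<subseteq> V" using AV by auto
  ultimately show ?thesis using r(1) by (intro exI[of _ "A - R"] exI[of _ r]) auto
qed

section \<open>A round of peeling that loses few vertices\<close>

lemma peel_subset: "peel E k M V m \<subseteq> V"
  by (induction m) auto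

lemma peel_antimono: "m \<le> m' \<Longrightarrow> peel E k M V m' \<subseteq> peel E k M V m"
  by (induction m' rule: dec_induct) auto

lemma peel_pigeonhole:
  assumes "finite V" "D > 0"
  shows "\<exists>d<D. D * card (peel E k M V d - peel E k M V (Suc d)) \<le> card V"
proof (rule ccontr)
  let ?A = "peel E k M V"
  assume "\<not> ?thesis"
  then have "card V < D * card (?A d - ?A (Suc d))" if "d < D" for d using that by force
  then have "(\<Sum>d<D. card V) < (\<Sum>d<D. D * card (?A d - ?A (Suc d)))"
    using assms by (intro sum_strict_mono) auto
  then have 1: "D * card V < D * (\<Sum>d<D. card (?A d - ?A (Suc d)))" by (simp add: sum_distrib_left)
  have fin: "finite (?A m)" for m using peel_subset assms(1) finite_subset by metis
  have "(\<Sum>d<D. card (?A d - ?A (Suc d))) + card (?A D) = card V"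
  proof (induction D)
    case (Suc D)
    have sub: "?A (Suc D) \<subseteq> ?A D" by (rule peel_antimono) simp
    have "card (?A D - ?A (Suc D)) + card (?A (Suc D)) = card (?A D)"
      using card_Diff_subset[OF fin[of "Suc D"] sub] card_mono[OF fin[of D] sub] by linarith
    then show ?case using Suc by (simp del: peel.simps)
  qed simp
  then show False using 1 by auto
qed

section \<open>The component game\<close>

lemma claimed_snoc: "claimed P (h @ [(Q, S)]) = claimed P h \<union> (if P = Q then S else {})"
  by (auto simp: claimed_def)

lemma claimed_Nil [simp]: "claimed P [] = {}"
  by (simp add: claimed_def)

lemma unclaimed_snoc: "unclaimed E (h @ [(Q, S)]) = unclaimed E h - S"
  by (cases Q) (auto simp: unclaimed_def claimed_snoc)

lemma to_move_snoc: "to_move first (h @ [x]) = opponent (to_move first h)"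
  by (cases first) (auto simp: to_move_def)

lemma claimed_Maker_subset:
  assumes "play b first E \<sigma> h" "maker_strategy E \<sigma>"
  shows "claimed Maker h \<subseteq> E"
  using assms
  by (induction rule: play.induct) (auto simp: claimed_snoc maker_strategy_def unclaimed_def)

text \<open>A guarantee speaks of finished plays only. Without one, every size would be guaranteed
  vacuously and the \<open>GREATEST\<close> in \<open>s_star\<close> would lack a bound.\<close>

lemma play_completes:
  assumes "finite E" "b \<ge> 1" "maker_strategy E \<sigma>" "play b first E \<sigma> h"
  shows "\<exists>h'. play b first E \<sigma> h' \<and> unclaimed E h' = {}"
  using assms(4)
proof (induction "card (unclaimed E h)" arbitrary: h rule: less_induct)
  case less
  have f: "finite (unclaimed E h)" using assms(1) by (simp add: unclaimed_def)
  show ?case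
  proof (cases "unclaimed E h = {}")
    case True then show ?thesis using less by blast
  next
    case False
    show ?thesis
    proof (cases "to_move first h")
      case Maker
      have "card (unclaimed E (h @ [(Maker, {\<sigma> h})])) < card (unclaimed E h)"
        using False assms(3) f unfolding unclaimed_snoc maker_strategy_def by (intro card_Diff1_less) auto
      then show ?thesis using less(1)[OF _ play.maker[OF less(2) False Maker]] by simp
    next
      case Breaker
      obtain S where S: "S \<subseteq> unclaimed E h" "card S = min b (card (unclaimed E h))"
        by (rule obtain_subset_with_card_n[OF min.cobounded2[of b "card (unclaimed E h)"]])
      have "card S > 0" using S(2) False f assms(2) by (simp add: card_gt_0_iff)
      then have "S \<noteq> {}" by auto
      then have "unclaimed E h - S \<subset> unclaimed E h" using S(1) by blast
      then have "card (unclaimed E (h @ [(Breaker, S)])) < card (unclaimed E h)"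
        unfolding unclaimed_snoc by (rule psubset_card_mono[OF f])
      then show ?thesis using less(1)[OF _ play.breaker[OF less(2) False Breaker S]] by simp
    qed
  qed
qed

lemma component_of_subset:
  assumes "F \<subseteq> all_edges V" "v \<in> V"
  shows "component_of F v \<subseteq> V"
proof
  fix w assume "w \<in> component_of F v"
  then have "(v, w) \<in> {(x, y). {x, y} \<in> F}\<^sup>*" by (simp add: component_of_def)
  then show "w \<in> V"
    by (induction rule: rtrancl_induct) (use assms in \<open>auto simp: all_edges_def\<close>)
qed

lemma s_star_ge:
  assumes fV: "finite V" and EV: "E \<subseteq> all_edges V" and b: "b \<ge> 1"
    and g: "maker_can_guarantee b first V E s"
  shows "s \<le> s_star b first V E"
  unfolding s_star_def
proof (rule Greatest_le_nat[where b="card V"])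
  show "maker_can_guarantee b first V E s" by fact
next
  fix t assume "maker_can_guarantee b first V E t"
  then obtain \<sigma> where \<sigma>: "maker_strategy E \<sigma>"
    "\<And>h. play b first E \<sigma> h \<Longrightarrow> unclaimed E h = {} \<Longrightarrow> \<exists>v\<in>V. card (component_of (claimed Maker h) v) \<ge> t"
    by (auto simp: maker_can_guarantee_def)
  obtain h where h: "play b first E \<sigma> h" "unclaimed E h = {}"
    using play_completes[OF finite_edges[OF fV EV] b \<sigma>(1) play.start] by blast
  obtain v where v: "v \<in> V" "card (component_of (claimed Maker h) v) \<ge> t" using \<sigma>(2)[OF h] by blast
  have "component_of (claimed Maker h) v \<subseteq> V"
    using component_of_subset[of "claimed Maker h" V v] claimed_Maker_subset[OF h(1) \<sigma>(1)] EV v by blast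
  then show "t \<le> card V" by (rule le_trans[OF v(2) card_mono[OF fV]])
qed

section \<open>Growing a single component\<close>

lemma component_of_mono: "F \<subseteq> F' \<Longrightarrow> component_of F v \<subseteq> component_of F' v"
  unfolding component_of_def by (intro Image_mono rtrancl_mono) auto

lemma component_of_self: "v \<in> component_of F v"
  by (simp add: component_of_def)

text \<open>As all edges of \<open>F\<close> lie in the component, the endpoint \<open>y\<close>
  brings no further vertices along.\<close>

lemma component_of_extend:
  assumes F: "\<And>e. e \<in> F \<Longrightarrow> e \<subseteq> component_of F r" and x: "x \<in> component_of F r"
  shows "component_of (insert {x, y} F) r = insert y (component_of F r)"
proof
  let ?F' = "insert {x, y} F"
  have 1: "component_of F r \<subseteq> component_of ?F' r" by (rule component_of_mono) auto
  moreover have "y \<in> component_of ?F' r"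
  proof -
    have "(r, x) \<in> {(x, y). {x, y} \<in> ?F'}\<^sup>*" using 1 x by (auto simp: component_of_def)
    then have "(r, y) \<in> {(x, y). {x, y} \<in> ?F'}\<^sup>*" by (rule rtrancl_into_rtrancl) auto
    then show ?thesis by (simp add: component_of_def)
  qed
  ultimately show "insert y (component_of F r) \<subseteq> component_of ?F' r" by auto
  show "component_of ?F' r \<subseteq> insert y (component_of F r)"
  proof
    fix w assume "w \<in> component_of ?F' r"
    then have "(r, w) \<in> {(x, y). {x, y} \<in> ?F'}\<^sup>*" by (simp add: component_of_def)
    then show "w \<in> insert y (component_of F r)"
    proof (induction rule: rtrancl_induct)
      case base then show ?case by (simp add: component_of_self)
    next
      case (step u w)
      then show ?case using F[of "{u, w}"] x by (auto simp: doubleton_eq_iff)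
    qed
  qed
qed

lemma component_conn_from:
  assumes "F \<subseteq> E" shows "conn_from E r (component_of F r)"
  unfolding conn_from_def
proof
  fix x assume "x \<in> component_of F r"
  then have "(r, x) \<in> {(x, y). {x, y} \<in> F}\<^sup>*" by (simp add: component_of_def)
  then show "(r, x) \<in> {(u, v). u \<in> component_of F r \<and> v \<in> component_of F r \<and> {u, v} \<in> E}\<^sup>*"
  proof (induction rule: rtrancl_induct)
    case (step y z)
    have y: "y \<in> component_of F r" using step by (simp add: component_of_def)
    have "(r, z) \<in> {(x, y). {x, y} \<in> F}\<^sup>*" using step by (auto intro: rtrancl_into_rtrancl)
    then have "z \<in> component_of F r" by (simp add: component_of_def)
    then show ?case using step y assms by (auto intro: rtrancl_into_rtrancl)
  qed simp
qed

text \<open>\<open>maker_strategy\<close> demands a legal move after every history, reachable or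
  not; hence the fallback to an arbitrary unclaimed edge.\<close>

definition grow_strategy :: "'v set set \<Rightarrow> 'v set \<Rightarrow> 'v \<Rightarrow> 'v history \<Rightarrow> 'v set" where
  "grow_strategy E K r h =
     (let T = component_of (claimed Maker h) r; B = unclaimed E h \<inter> boundary E T (K - T)
      in SOME e. e \<in> (if B \<noteq> {} then B else unclaimed E h))"

lemma grow_strategy_valid: "maker_strategy E (grow_strategy E K r)"
  unfolding maker_strategy_def
proof (intro allI impI)
  fix h assume "unclaimed E h \<noteq> {}"
  let ?T = "component_of (claimed Maker h) r"
  let ?B = "unclaimed E h \<inter> boundary E ?T (K - ?T)"
  have "(if ?B \<noteq> {} then ?B else unclaimed E h) \<noteq> {}" using \<open>unclaimed E h \<noteq> {}\<close> by simp
  then have "grow_strategy E K r h \<in> (if ?B \<noteq> {} then ?B else unclaimed E h)"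
    unfolding grow_strategy_def Let_def by (rule some_in_eq[THEN iffD2])
  then show "grow_strategy E K r h \<in> unclaimed E h" by (auto split: if_splits)
qed

lemma grow_strategy_boundary:
  assumes "T = component_of (claimed Maker h) r" "unclaimed E h \<inter> boundary E T (K - T) \<noteq> {}"
  shows "grow_strategy E K r h \<in> unclaimed E h \<inter> boundary E T (K - T)"
  unfolding grow_strategy_def Let_def assms(1)[symmetric] if_P[OF assms(2)]
  by (rule some_in_eq[THEN iffD2, OF assms(2)])

text \<open>Once all edges between Maker's component and the rest of \<open>K\<close> are claimed, Breaker owns all of
  them, but he has made at most as many moves as the component has vertices.\<close>

lemma maker_wins_if_expanding:
  assumes fV: "finite V" and EV: "E \<subseteq> all_edges V" and r: "r \<in> K" and KV: "K \<subseteq> V"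
    and ex: "\<And>T. T \<subseteq> K \<Longrightarrow> r \<in> T \<Longrightarrow> conn_from E r T \<Longrightarrow> card T < s \<Longrightarrow> b * card T < card (boundary E T (K - T))"
  shows "maker_can_guarantee b first V E s"
proof -
  have fE: "finite E" by (rule finite_edges[OF fV EV])
  define \<sigma> where "\<sigma> = grow_strategy E K r"
  have strat: "maker_strategy E \<sigma>" unfolding \<sigma>_def by (rule grow_strategy_valid)
  define T where "T h = component_of (claimed Maker h) r" for h
  \<comment> \<open>\<open>i\<close> counts Maker's moves and \<open>j\<close> bounds Breaker's. One
    extra Breaker move is allowed when Maker is to move, which covers both choices of the first
    player.\<close>
  define I where "I h \<longleftrightarrow> T h \<subseteq> K \<and> (\<forall>e\<in>claimed Maker h. e \<subseteq> T h) \<and>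
    (\<exists>i j. card (T h) = Suc i \<and> card (claimed Breaker h) \<le> b * j \<and>
       j \<le> i + (if to_move first h = Breaker then 0 else 1))" for h
  have fT: "finite (T h)" if "play b first E \<sigma> h" for h
  proof -
    have "T h \<subseteq> V" unfolding T_def using component_of_subset[of "claimed Maker h" V r]
      claimed_Maker_subset[OF that strat] EV r KV by blast
    then show ?thesis using fV finite_subset by blast
  qed
  have open_edge: "unclaimed E h \<inter> boundary E (T h) (K - T h) \<noteq> {}"
    if p: "play b first E \<sigma> h" and I: "I h" and lt: "card (T h) < s" for h
  proof
    assume emp: "unclaimed E h \<inter> boundary E (T h) (K - T h) = {}"
    have rT: "r \<in> T h" by (simp add: T_def component_of_self)
    have "conn_from E r (T h)" unfolding T_def
      by (rule component_conn_from) (rule claimed_Maker_subset[OF p strat])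
    then have lt2: "b * card (T h) < card (boundary E (T h) (K - T h))"
      using ex[of "T h"] I rT lt by (auto simp: I_def)
    have "boundary E (T h) (K - T h) \<subseteq> claimed Breaker h"
    proof
      fix e assume e: "e \<in> boundary E (T h) (K - T h)"
      then have "e \<in> E" "\<not> e \<subseteq> T h" by (auto simp: boundary_def)
      then show "e \<in> claimed Breaker h" using e emp I by (auto simp: unclaimed_def I_def)
    qed
    moreover have "finite (claimed Breaker h)"
      using p by (induction rule: play.induct)
        (auto simp: claimed_snoc unclaimed_def intro: finite_subset[OF _ fE])
    ultimately have "card (boundary E (T h) (K - T h)) \<le> card (claimed Breaker h)" by (intro card_mono)
    moreover obtain i j where ij: "card (T h) = Suc i" "card (claimed Breaker h) \<le> b * j"
      "j \<le> i + (if to_move first h = Breaker then 0 else 1)" using I by (auto simp: I_def)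
    moreover have "j \<le> Suc i" using ij(3) by (auto split: if_splits)
    then have "b * j \<le> b * card (T h)" unfolding ij(1) by (rule mult_left_mono) simp
    ultimately show False using lt2 by linarith
  qed
  \<comment> \<open>Once the component has \<open>s\<close> vertices, \<open>I\<close> may fail, as
    Maker may then claim edges elsewhere.\<close>
  have inv: "s \<le> card (T h) \<or> I h" if "play b first E \<sigma> h" for h
    using that
  proof (induction rule: play.induct)
    case start
    have "T [] = {r}" by (auto simp: T_def component_of_def)
    then show ?case using r by (auto simp: I_def)
  next
    case (maker h)
    let ?h = "h @ [(Maker, {\<sigma> h})]"
    have p: "play b first E \<sigma> ?h" by (rule play.maker) (use maker in auto)
    have cl: "claimed Maker ?h = insert (\<sigma> h) (claimed Maker h)" by (auto simp: claimed_snoc)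
    have sub: "T h \<subseteq> T ?h" unfolding T_def by (rule component_of_mono) (auto simp: cl)
    have big: "card (T h) \<le> card (T ?h)" using sub fT[OF p] by (intro card_mono)
    show ?case
    proof (cases "s \<le> card (T h)")
      case True then show ?thesis using big by simp
    next
      case False
      then have I: "I h" using maker by auto
      have "\<sigma> h \<in> unclaimed E h \<inter> boundary E (T h) (K - T h)"
        unfolding \<sigma>_def
        by (rule grow_strategy_boundary) (use open_edge[OF maker(1) I] False in \<open>auto simp: T_def\<close>)
      then obtain x y where xy: "x \<in> T h" "y \<in> K - T h" "\<sigma> h = {x, y}" by (auto simp: boundary_def)
      have cl': "claimed Maker ?h = insert {x, y} (claimed Maker h)" using cl xy(3) by simp
      have Tn: "T ?h = insert y (T h)"
        unfolding T_def cl' by (rule component_of_extend) (use I xy(1) in \<open>auto simp: I_def T_def\<close>)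
      obtain i j where ij: "card (T h) = Suc i" "card (claimed Breaker h) \<le> b * j" "j \<le> i + 1"
        using I maker(3) by (auto simp: I_def)
      have "card (T ?h) = Suc (Suc i)" using Tn ij xy(2) fT[OF maker(1)] by simp
      moreover have "claimed Breaker ?h = claimed Breaker h" by (simp add: claimed_snoc)
      moreover have "to_move first ?h = Breaker" using maker(3) by (simp add: to_move_snoc)
      ultimately have "I ?h" using I xy ij unfolding I_def Tn cl
        by (auto intro!: exI[of _ j])
      then show ?thesis by simp
    qed
  next
    case (breaker h S)
    let ?h = "h @ [(Breaker, S)]"
    have cl: "claimed Maker ?h = claimed Maker h" "claimed Breaker ?h = claimed Breaker h \<union> S"
      by (auto simp: claimed_snoc)
    have T: "T ?h = T h" by (simp add: T_def cl)
    show ?case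
    proof (cases "s \<le> card (T h)")
      case True then show ?thesis using T by simp
    next
      case False
      then have I: "I h" using breaker by auto
      obtain i j where ij: "card (T h) = Suc i" "card (claimed Breaker h) \<le> b * j" "j \<le> i"
        using I breaker(3) by (auto simp: I_def)
      have "card (claimed Breaker ?h) \<le> card (claimed Breaker h) + card S" unfolding cl by (rule card_Un_le)
      also have "\<dots> \<le> b * Suc j" using ij breaker(5) by simp
      finally have "card (claimed Breaker ?h) \<le> b * Suc j" .
      moreover have "to_move first ?h = Maker" using breaker(3) by (simp add: to_move_snoc)
      ultimately have "I ?h" using I ij unfolding I_def T cl(1)
        by (auto intro!: exI[of _ "Suc j"])
      then show ?thesis by simp
    qed
  qed
  have "\<exists>v\<in>V. s \<le> card (component_of (claimed Maker h) v)" if h: "play b first E \<sigma> h" "unclaimed E h = {}" for h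
  proof -
    have "s \<le> card (T h)" using inv[OF h(1)] open_edge[OF h(1)] h(2) by force
    then show ?thesis using r KV unfolding T_def by blast
  qed
  then show ?thesis unfolding maker_can_guarantee_def using strat by blast
qed

section \<open>Random subsets\<close>

text \<open>An arbitrary ground set allows the edges of the random graph to be cut into independent
  parts.\<close>

definition rand_subset :: "'a set \<Rightarrow> real \<Rightarrow> 'a set pmf" where
  "rand_subset A p = map_pmf (\<lambda>f. {e \<in> A. f e}) (Pi_pmf A False (\<lambda>_. bernoulli_pmf p))"

lemma gnp_rand_subset: "gnp n p = rand_subset (all_edges {1..n}) p"
  by (simp add: gnp_def rand_subset_def)

lemma finite_all_edges: "finite V \<Longrightarrow> finite (all_edges V)"
  by (rule finite_edges) auto

lemma prob_cong_set_pmf: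
  assumes "A \<inter> set_pmf M = B \<inter> set_pmf M"
  shows "measure_pmf.prob M A = measure_pmf.prob M B"
  using measure_Int_set_pmf[of M A] measure_Int_set_pmf[of M B] assms by simp

lemma set_rand_subset: "set_pmf (rand_subset A p) \<subseteq> Pow A"
  by (auto simp: rand_subset_def)

lemma prob_rand_subset_Pow:
  "measure_pmf.prob (rand_subset A p) X = measure_pmf.prob (rand_subset A p) (X \<inter> Pow A)"
proof -
  have "measure_pmf.prob (rand_subset A p) X = measure_pmf.prob (rand_subset A p) (X \<inter> set_pmf (rand_subset A p))"
    by (simp add: measure_Int_set_pmf)
  also have "\<dots> \<le> measure_pmf.prob (rand_subset A p) (X \<inter> Pow A)"
    using set_rand_subset[of A p] by (intro measure_pmf.finite_measure_mono) auto
  finally show ?thesis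
    using measure_pmf.finite_measure_mono[of "X \<inter> Pow A" X "rand_subset A p"] by auto
qed

lemma prob_rand_subset_mono:
  assumes "\<And>F. F \<in> X \<Longrightarrow> F \<subseteq> A \<Longrightarrow> F \<in> Y"
  shows "measure_pmf.prob (rand_subset A p) X \<le> measure_pmf.prob (rand_subset A p) Y"
  by (subst prob_rand_subset_Pow, rule measure_pmf.finite_measure_mono) (use assms in auto)

lemma pmf_rand_subset:
  assumes "finite A" "C \<subseteq> A" "0 \<le> p" "p \<le> 1"
  shows "pmf (rand_subset A p) C = p ^ card C * (1 - p) ^ (card A - card C)"
proof -
  let ?M = "Pi_pmf A False (\<lambda>_. bernoulli_pmf p)"
  have "pmf (rand_subset A p) C = measure_pmf.prob ?M ((\<lambda>f. {e \<in> A. f e}) -` {C})"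
    by (simp add: rand_subset_def pmf_map)
  also have "\<dots> = measure_pmf.prob ?M {\<lambda>e. e \<in> C}"
  proof -
    have "((\<lambda>f. {e \<in> A. f e}) -` {C}) \<inter> set_pmf ?M = {\<lambda>e. e \<in> C} \<inter> set_pmf ?M"
      using set_Pi_pmf_subset[OF assms(1), of False "\<lambda>_. bernoulli_pmf p"] assms(2)
      by (fastforce simp: fun_eq_iff)
    then show ?thesis by (rule prob_cong_set_pmf)
  qed
  also have "\<dots> = (\<Prod>x\<in>A. pmf (bernoulli_pmf p) (x \<in> C))"
    using assms by (subst measure_pmf_single, subst pmf_Pi') auto
  also have "\<dots> = (\<Prod>x\<in>A. if x \<in> C then p else 1 - p)" using assms by (intro prod.cong) auto
  also have "\<dots> = p ^ card C * (1 - p) ^ card (A - C)"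
    using assms by (simp add: prod.If_cases Int_absorb1 Diff_eq[symmetric])
  finally show ?thesis using assms by (simp add: card_Diff_subset finite_subset)
qed

lemma rand_subset_union:
  assumes "finite A" "finite B" "A \<inter> B = {}"
  shows "rand_subset (A \<union> B) p = map_pmf (\<lambda>(X, Y). X \<union> Y) (pair_pmf (rand_subset A p) (rand_subset B p))"
proof -
  let ?P = "\<lambda>A. Pi_pmf A False (\<lambda>_. bernoulli_pmf p)"
  have "rand_subset (A \<union> B) p =
      map_pmf (\<lambda>(f, g). {e \<in> A \<union> B. if e \<in> A then f e else g e}) (pair_pmf (?P A) (?P B))"
    unfolding rand_subset_def Pi_pmf_union[OF assms] map_pmf_comp o_def case_prod_unfold by simp
  also have "(\<lambda>(f, g). {e \<in> A \<union> B. if e \<in> A then f e else g e})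
      = (\<lambda>(X, Y). X \<union> Y) \<circ> (\<lambda>(f, g). ({e \<in> A. f e}, {e \<in> B. g e}))"
    using assms(3) by (auto simp: fun_eq_iff)
  also have "map_pmf \<dots> (pair_pmf (?P A) (?P B)) =
      map_pmf (\<lambda>(X, Y). X \<union> Y) (pair_pmf (rand_subset A p) (rand_subset B p))"
    unfolding rand_subset_def map_pair[symmetric] map_pmf_comp o_def by simp
  finally show ?thesis .
qed

lemma prob_rand_subset_union:
  assumes "finite A" "finite B" "A \<inter> B = {}"
  shows "measure_pmf.prob (rand_subset (A \<union> B) p) Z =
    measure_pmf.prob (pair_pmf (rand_subset A p) (rand_subset B p)) {(X, Y). X \<union> Y \<in> Z \<and> X \<subseteq> A \<and> Y \<subseteq> B}"
proof -
  let ?M = "pair_pmf (rand_subset A p) (rand_subset B p)"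
  have "measure_pmf.prob (rand_subset (A \<union> B) p) Z = measure_pmf.prob ?M ((\<lambda>(X, Y). X \<union> Y) -` Z)"
    unfolding rand_subset_union[OF assms] by simp
  also have "\<dots> = measure_pmf.prob ?M {(X, Y). X \<union> Y \<in> Z \<and> X \<subseteq> A \<and> Y \<subseteq> B}"
  proof -
    have "((\<lambda>(X, Y). X \<union> Y) -` Z) \<inter> set_pmf ?M
        = {(X, Y). X \<union> Y \<in> Z \<and> X \<subseteq> A \<and> Y \<subseteq> B} \<inter> set_pmf ?M"
      using set_rand_subset[of A p] set_rand_subset[of B p] by auto
    then show ?thesis by (rule prob_cong_set_pmf)
  qed
  finally show ?thesis .
qed

lemma prob_rand_subset_Int:
  assumes "finite A" "B \<subseteq> A"
  shows "measure_pmf.prob (rand_subset A p) {X. X \<inter> B \<in> Z} = measure_pmf.prob (rand_subset B p) Z"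
proof -
  have fB: "finite B" using assms finite_subset by blast
  let ?M = "pair_pmf (rand_subset B p) (rand_subset (A - B) p)"
  have "A = B \<union> (A - B)" using assms by auto
  then have "measure_pmf.prob (rand_subset A p) {X. X \<inter> B \<in> Z} = measure_pmf.prob (rand_subset (B \<union> (A - B)) p) {X. X \<inter> B \<in> Z}"
    by simp
  also have "\<dots> = measure_pmf.prob ?M {(X, Y). X \<union> Y \<in> {X. X \<inter> B \<in> Z} \<and> X \<subseteq> B \<and> Y \<subseteq> A - B}"
    using assms fB by (intro prob_rand_subset_union) auto
  also have "{(X, Y). X \<union> Y \<in> {X. X \<inter> B \<in> Z} \<and> X \<subseteq> B \<and> Y \<subseteq> A - B}
     = {(X, Y). X \<in> Z \<and> X \<subseteq> B \<and> Y \<subseteq> A - B}"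
  proof -
    have "(X \<union> Y) \<inter> B = X" if "X \<subseteq> B" "Y \<subseteq> A - B" for X Y using that by auto
    then show ?thesis by auto
  qed
  also have "measure_pmf.prob ?M \<dots> = measure_pmf.prob ?M (fst -` Z)"
  proof -
    have "{(X, Y). X \<in> Z \<and> X \<subseteq> B \<and> Y \<subseteq> A - B} \<inter> set_pmf ?M = fst -` Z \<inter> set_pmf ?M"
      using set_rand_subset[of B p] set_rand_subset[of "A - B" p] by auto
    then show ?thesis by (rule prob_cong_set_pmf)
  qed
  also have "\<dots> = measure_pmf.prob (map_pmf fst ?M) Z" by simp
  also have "\<dots> = measure_pmf.prob (rand_subset B p) Z" by (simp only: map_fst_pair_pmf)
  finally show ?thesis .
qed

lemma prob_superset:
  assumes "finite A" "D \<subseteq> A" "0 \<le> p" "p \<le> 1"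
  shows "measure_pmf.prob (rand_subset A p) {F. D \<subseteq> F} = p ^ card D"
proof -
  have "{F. D \<subseteq> F} = {X. X \<inter> D \<in> {D}}" by auto
  then have "measure_pmf.prob (rand_subset A p) {F. D \<subseteq> F} = pmf (rand_subset D p) D"
    using prob_rand_subset_Int[OF assms(1,2), of p "{D}"] by (simp add: measure_pmf_single)
  also have "\<dots> = p ^ card D" using assms by (subst pmf_rand_subset) (auto intro: finite_subset)
  finally show ?thesis .
qed

text \<open>Fubini: given \<open>X\<close>, the section has probability at most
  \<open>\<rho>\<close>, or at most 1 if \<open>X\<close> is in \<open>Exc\<close>.\<close>

lemma prob_pair_le:
  assumes Exc: "measure_pmf.prob M Exc \<le> \<tau>" and \<rho>: "0 \<le> \<rho>"
    and Z: "\<And>X. X \<in> set_pmf M \<Longrightarrow> X \<notin> Exc \<Longrightarrow> measure_pmf.prob N {Y. (X, Y) \<in> Z} \<le> \<rho>"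
  shows "measure_pmf.prob (pair_pmf M N) Z \<le> \<tau> + \<rho>"
proof -
  have \<tau>: "0 \<le> \<tau>" using Exc measure_nonneg[of M Exc] by linarith
  have "emeasure (pair_pmf M N) Z = (\<integral>\<^sup>+ z. indicator Z z \<partial>pair_pmf M N)" by simp
  also have "\<dots> = (\<integral>\<^sup>+ X. \<integral>\<^sup>+ Y. indicator Z (X, Y) \<partial>N \<partial>M)" by (rule nn_integral_pair_pmf')
  also have "\<dots> = (\<integral>\<^sup>+ X. emeasure N {Y. (X, Y) \<in> Z} \<partial>M)"
  proof (intro nn_integral_cong)
    fix X
    have "(\<integral>\<^sup>+ Y. indicator Z (X, Y) \<partial>N) = (\<integral>\<^sup>+ Y. indicator {Y. (X, Y) \<in> Z} Y \<partial>N)"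
      by (intro nn_integral_cong) (auto simp: indicator_def)
    then show "(\<integral>\<^sup>+ Y. indicator Z (X, Y) \<partial>N) = emeasure N {Y. (X, Y) \<in> Z}" by simp
  qed
  also have "\<dots> \<le> (\<integral>\<^sup>+ X. (indicator Exc X + ennreal \<rho>) \<partial>M)"
  proof (intro nn_integral_mono_AE, unfold AE_measure_pmf_iff, intro ballI)
    fix X assume X: "X \<in> set_pmf M"
    show "emeasure N {Y. (X, Y) \<in> Z} \<le> indicator Exc X + ennreal \<rho>"
    proof (cases "X \<in> Exc")
      case True
      have "emeasure N {Y. (X, Y) \<in> Z} \<le> 1" by (rule measure_pmf.emeasure_le_1)
      then show ?thesis using True by (simp add: add_increasing2)
    next
      case False
      then show ?thesis using Z[OF X False] by (simp add: measure_pmf.emeasure_eq_measure ennreal_leI)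
    qed
  qed
  also have "\<dots> = emeasure M Exc + ennreal \<rho>"
    by (subst nn_integral_add) (auto simp: measure_pmf.emeasure_space_1)
  also have "\<dots> \<le> ennreal (\<tau> + \<rho>)"
    using Exc \<rho> \<tau> by (simp add: measure_pmf.emeasure_eq_measure ennreal_plus ennreal_leI add_mono)
  finally have "ennreal (measure_pmf.prob (pair_pmf M N) Z) \<le> ennreal (\<tau> + \<rho>)"
    by (simp add: measure_pmf.emeasure_eq_measure)
  then show ?thesis using \<tau> \<rho> by (subst (asm) ennreal_le_iff) auto
qed

lemma prob_blocks:
  assumes "finite R" "\<And>v. v \<in> R \<Longrightarrow> finite (blk v)"
    "\<And>v w. v \<in> R \<Longrightarrow> w \<in> R \<Longrightarrow> v \<noteq> w \<Longrightarrow> blk v \<inter> blk w = {}"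
    "\<And>v. v \<in> R \<Longrightarrow> measure_pmf.prob (rand_subset (blk v) p) {Y. Q v Y} \<le> q" "0 \<le> q"
  shows "measure_pmf.prob (rand_subset (\<Union>v\<in>R. blk v) p) {X. \<forall>v\<in>R. Q v (X \<inter> blk v)} \<le> q ^ card R"
  using assms(1-4)
proof (induction rule: finite_induct)
  case empty
  then show ?case by (simp add: measure_pmf.prob_le_1)
next
  case (insert v R)
  let ?U = "\<Union>w\<in>R. blk w"
  let ?A = "{X \<in> Pow (blk v). Q v X}" and ?B = "{Y \<in> Pow ?U. \<forall>w\<in>R. Q w (Y \<inter> blk w)}"
  have fU: "finite ?U" using insert by auto
  have dis: "blk v \<inter> ?U = {}" using insert.prems(2)[of v] insert.hyps by auto
  have "measure_pmf.prob (rand_subset (blk v \<union> ?U) p) {X. \<forall>w\<in>insert v R. Q w (X \<inter> blk w)}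
    = measure_pmf.prob (pair_pmf (rand_subset (blk v) p) (rand_subset ?U p))
        {(X, Y). X \<union> Y \<in> {X. \<forall>w\<in>insert v R. Q w (X \<inter> blk w)} \<and> X \<subseteq> blk v \<and> Y \<subseteq> ?U}"
    using insert fU dis by (intro prob_rand_subset_union) auto
  also have "{(X, Y). X \<union> Y \<in> {X. \<forall>w\<in>insert v R. Q w (X \<inter> blk w)} \<and> X \<subseteq> blk v \<and> Y \<subseteq> ?U} = ?A \<times> ?B"
  proof -
    have 1: "(X \<union> Y) \<inter> blk v = X" if "X \<subseteq> blk v" "Y \<subseteq> ?U" for X Y using that dis by blast
    have 2: "(X \<union> Y) \<inter> blk w = Y \<inter> blk w" if "X \<subseteq> blk v" "w \<in> R" for X Y w using that dis by blast
    have "(X \<union> Y \<in> {X. \<forall>w\<in>insert v R. Q w (X \<inter> blk w)} \<and> X \<subseteq> blk v \<and> Y \<subseteq> ?U) \<longleftrightarrow> X \<in> ?A \<and> Y \<in> ?B" for X Y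
    proof (cases "X \<subseteq> blk v \<and> Y \<subseteq> ?U")
      case True
      then show ?thesis using 1[of X Y] 2[of X _ Y] by simp
    qed auto
    then have "{(X, Y). X \<union> Y \<in> {X. \<forall>w\<in>insert v R. Q w (X \<inter> blk w)} \<and> X \<subseteq> blk v \<and> Y \<subseteq> ?U}
        = {(X, Y). X \<in> ?A \<and> Y \<in> ?B}"
      by (simp only:)
    moreover have "{(X, Y). X \<in> ?A \<and> Y \<in> ?B} = ?A \<times> ?B"
      by (rule set_eqI) (simp only: mem_Collect_eq split_def mem_Times_iff)
    ultimately show ?thesis by (simp only:)
  qed
  also have "measure_pmf.prob (pair_pmf (rand_subset (blk v) p) (rand_subset ?U p)) (?A \<times> ?B)
    = measure_pmf.prob (rand_subset (blk v) p) ?A * measure_pmf.prob (rand_subset ?U p) ?B"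
    using insert fU by (intro measure_pmf_prob_product) (auto intro!: countable_finite)
  also have "\<dots> \<le> q * q ^ card R"
  proof (intro mult_mono)
    have "measure_pmf.prob (rand_subset (blk v) p) ?A \<le> measure_pmf.prob (rand_subset (blk v) p) {Y. Q v Y}"
      by (rule prob_rand_subset_mono) auto
    also have "\<dots> \<le> q" using insert by auto
    finally show "measure_pmf.prob (rand_subset (blk v) p) ?A \<le> q" .
    have "measure_pmf.prob (rand_subset ?U p) ?B \<le> measure_pmf.prob (rand_subset ?U p) {X. \<forall>w\<in>R. Q w (X \<inter> blk w)}"
      by (rule prob_rand_subset_mono) auto
    also have "\<dots> \<le> q ^ card R" using insert by auto
    finally show "measure_pmf.prob (rand_subset ?U p) ?B \<le> q ^ card R" .
  qed (use assms(5) in auto)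
  finally show ?case using insert by simp
qed

text \<open>The probability that \<open>sat\<close> fails when each of \<open>N\<close> good
  vertices, \<open>N'\<close> of them with a smaller label, is a child with probability
  \<open>p\<close>: at most \<open>a\<close> are chosen, unless exactly \<open>a\<close> are chosen
  and all belong to the \<open>N'\<close>.\<close>

definition bin_fail :: "nat \<Rightarrow> nat \<Rightarrow> nat \<Rightarrow> real \<Rightarrow> real" where
  "bin_fail a N N' p = (\<Sum>i\<le>a. real (N choose i) * p ^ i * (1 - p) ^ (N - i))
     - real (N' choose a) * p ^ a * (1 - p) ^ (N - a)"

lemma prob_bin_fail:
  assumes "finite B" "B' \<subseteq> B" "0 \<le> p" "p \<le> 1"
  shows "measure_pmf.prob (rand_subset B p) {Y. \<not> (a < card (Y \<inter> B) \<or> a \<le> card (Y \<inter> B'))}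
    = bin_fail a (card B) (card B') p"
proof -
  let ?M = "rand_subset B p"
  let ?S = "\<lambda>i. {Y. Y \<subseteq> B \<and> card Y = i}" and ?T = "{Y. Y \<subseteq> B' \<and> card Y = a}"
  have fB': "finite B'" using assms finite_subset by blast
  have fS: "finite (?S i)" for i by (rule finite_subset[of _ "Pow B"]) (use assms in auto)
  have fT: "finite ?T" by (rule finite_subset[of _ "Pow B'"]) (use fB' in auto)
  have fin: "finite Y" if "Y \<subseteq> B" for Y using that assms finite_subset by blast
  have sub: "?T \<subseteq> (\<Union>i\<le>a. ?S i)" using assms(2) by auto
  have iff: "\<not> (a < card (Y \<inter> B) \<or> a \<le> card (Y \<inter> B')) \<longleftrightarrow> Y \<in> (\<Union>i\<le>a. ?S i) - ?T" if Y: "Y \<subseteq> B" for Y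
  proof -
    have YB: "Y \<inter> B = Y" using Y by auto
    have le: "card (Y \<inter> B') \<le> card Y" by (intro card_mono fin Y) auto
    show ?thesis
    proof (cases "card Y = a")
      case True
      have "a \<le> card (Y \<inter> B') \<longleftrightarrow> Y \<subseteq> B'"
      proof
        assume "a \<le> card (Y \<inter> B')"
        then have "Y \<inter> B' = Y" using True fin[OF Y] by (intro card_seteq) auto
        then show "Y \<subseteq> B'" by auto
      next
        assume "Y \<subseteq> B'" then have "Y \<inter> B' = Y" by auto
        then show "a \<le> card (Y \<inter> B')" using True by simp
      qed
      then show ?thesis using True YB Y by auto
    next
      case False
      then show ?thesis using YB Y le by auto
    qed
  qed
  have "measure_pmf.prob ?M {Y. \<not> (a < card (Y \<inter> B) \<or> a \<le> card (Y \<inter> B'))}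
    = measure_pmf.prob ?M ({Y. \<not> (a < card (Y \<inter> B) \<or> a \<le> card (Y \<inter> B'))} \<inter> Pow B)"
    by (rule prob_rand_subset_Pow)
  also have "{Y. \<not> (a < card (Y \<inter> B) \<or> a \<le> card (Y \<inter> B'))} \<inter> Pow B = (\<Union>i\<le>a. ?S i) - ?T"
  proof (rule set_eqI)
    fix Y show "Y \<in> {Y. \<not> (a < card (Y \<inter> B) \<or> a \<le> card (Y \<inter> B'))} \<inter> Pow B \<longleftrightarrow> Y \<in> (\<Union>i\<le>a. ?S i) - ?T"
    proof (cases "Y \<subseteq> B")
      case True then show ?thesis using iff[OF True] by blast
    qed auto
  qed
  also have "measure_pmf.prob ?M \<dots> = (\<Sum>Y\<in>(\<Union>i\<le>a. ?S i) - ?T. pmf ?M Y)"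
    using fS by (intro measure_measure_pmf_finite) auto
  also have "\<dots> = (\<Sum>Y\<in>(\<Union>i\<le>a. ?S i). pmf ?M Y) - (\<Sum>Y\<in>?T. pmf ?M Y)"
    using fS sub by (intro sum_diff) auto
  also have "(\<Sum>Y\<in>(\<Union>i\<le>a. ?S i). pmf ?M Y) = (\<Sum>i\<le>a. \<Sum>Y\<in>?S i. pmf ?M Y)"
    using fS by (intro sum.UNION_disjoint) auto
  also have "\<dots> = (\<Sum>i\<le>a. real (card B choose i) * p ^ i * (1 - p) ^ (card B - i))"
  proof (intro sum.cong refl)
    fix i
    have "(\<Sum>Y\<in>?S i. pmf ?M Y) = (\<Sum>Y\<in>?S i. p ^ i * (1 - p) ^ (card B - i))"
      using assms by (intro sum.cong refl) (auto simp: pmf_rand_subset)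
    then show "(\<Sum>Y\<in>?S i. pmf ?M Y) = real (card B choose i) * p ^ i * (1 - p) ^ (card B - i)"
      using n_subsets[OF assms(1)] by simp
  qed
  also have "(\<Sum>Y\<in>?T. pmf ?M Y) = real (card B' choose a) * p ^ a * (1 - p) ^ (card B - a)"
  proof -
    have "(\<Sum>Y\<in>?T. pmf ?M Y) = (\<Sum>Y\<in>?T. p ^ a * (1 - p) ^ (card B - a))"
      using assms by (intro sum.cong refl) (auto simp: pmf_rand_subset)
    then show ?thesis using n_subsets[OF fB'] by simp
  qed
  finally show ?thesis by (simp add: bin_fail_def)
qed

section \<open>Sparsity of small sets\<close>

lemma power_le_exp_fact: "real t ^ t \<le> exp (real t) * fact t"
proof -
  have e: "(\<lambda>n. real t ^ n /\<^sub>R fact n) sums exp (real t)" by (rule exp_converges)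
  have "(\<Sum>n\<in>{t}. real t ^ n /\<^sub>R fact n) \<le> (\<Sum>n. real t ^ n /\<^sub>R fact n)"
    by (rule sum_le_suminf[OF sums_summable[OF e]]) auto
  then have "real t ^ t /\<^sub>R fact t \<le> exp (real t)" using sums_unique[OF e] by simp
  then show ?thesis by (simp add: field_simps)
qed

lemma binomial_power_bound: "real (n choose t) * real t ^ t \<le> exp (real t) * real n ^ t"
proof -
  have "real (n choose t) * real t ^ t \<le> real (n choose t) * (exp (real t) * fact t)"
    by (intro mult_left_mono power_le_exp_fact) auto
  also have "\<dots> = exp (real t) * real ((n choose t) * fact t)" by simp
  also have "\<dots> \<le> exp (real t) * real (n ^ t)"
    using binomial_fact_pow[of n t] by (intro mult_left_mono) (auto simp del: of_nat_mult of_nat_power)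
  finally show ?thesis by simp
qed

lemma card_all_edges_le:
  assumes "finite S" shows "card (all_edges S) \<le> card S ^ 2"
proof -
  have "all_edges S \<subseteq> (\<lambda>(x, y). {x, y}) ` (S \<times> S)"
    by (auto simp: all_edges_def card_2_iff image_iff)
  then have "card (all_edges S) \<le> card ((\<lambda>(x, y). {x, y}) ` (S \<times> S))" using assms by (intro card_mono) auto
  also have "\<dots> \<le> card (S \<times> S)" using assms by (intro card_image_le) auto
  finally show ?thesis by (simp add: power2_eq_square card_cartesian_product)
qed

text \<open>Union bound over \<open>S\<close> and over the \<open>k\<close> edges inside it, with
  \<open>t ^ 2\<close> bounding the number of pairs.\<close>

lemma prob_dense_sets_le:
  fixes V :: "'v set"
  assumes fV: "finite V" and p: "0 \<le> p" "p \<le> 1"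
  shows "measure_pmf.prob (rand_subset (all_edges V) p)
      {F. \<exists>S\<subseteq>V. card S = t \<and> k \<le> edges_in F S}
    \<le> real (card V choose t) * (real (t ^ 2 choose k) * p ^ k)"
proof -
  let ?M = "rand_subset (all_edges V) p"
  let ?\<S> = "{S. S \<subseteq> V \<and> card S = t}"
  let ?\<D> = "\<lambda>S. {D. D \<subseteq> all_edges S \<and> card D = k}"
  have fS: "finite ?\<S>" by (rule finite_subset[of _ "Pow V"]) (use fV in auto)
  have finS: "finite S" if "S \<subseteq> V" for S using that fV finite_subset by blast
  have fD: "finite (?\<D> S)" if "S \<subseteq> V" for S
    by (rule finite_subset[of _ "Pow (all_edges S)"]) (use finite_all_edges[OF finS[OF that]] in auto)
  have "measure_pmf.prob ?M {F. \<exists>S\<subseteq>V. card S = t \<and> k \<le> edges_in F S}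
      \<le> measure_pmf.prob ?M (\<Union>S\<in>?\<S>. \<Union>D\<in>?\<D> S. {F. D \<subseteq> F})"
  proof (rule prob_rand_subset_mono)
    fix F assume "F \<in> {F. \<exists>S\<subseteq>V. card S = t \<and> k \<le> edges_in F S}" and FA: "F \<subseteq> all_edges V"
    then obtain S where S: "S \<subseteq> V" "card S = t" "k \<le> card {e \<in> F. e \<subseteq> S}" by (auto simp: edges_in_def)
    obtain D where D: "D \<subseteq> {e \<in> F. e \<subseteq> S}" "card D = k"
      using obtain_subset_with_card_n[OF S(3)] by metis
    have "D \<subseteq> all_edges S" "D \<subseteq> F" using D(1) FA by (auto simp: all_edges_def)
    then show "F \<in> (\<Union>S\<in>?\<S>. \<Union>D\<in>?\<D> S. {F. D \<subseteq> F})" using S D by auto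
  qed
  also have "\<dots> \<le> (\<Sum>S\<in>?\<S>. measure_pmf.prob ?M (\<Union>D\<in>?\<D> S. {F. D \<subseteq> F}))"
    using fS by (intro measure_pmf.finite_measure_subadditive_finite) auto
  also have "\<dots> \<le> (\<Sum>S\<in>?\<S>. real (t ^ 2 choose k) * p ^ k)"
  proof (intro sum_mono)
    fix S assume S: "S \<in> ?\<S>"
    have SV: "S \<subseteq> V" using S by auto
    have "measure_pmf.prob ?M (\<Union>D\<in>?\<D> S. {F. D \<subseteq> F}) \<le> (\<Sum>D\<in>?\<D> S. measure_pmf.prob ?M {F. D \<subseteq> F})"
      using fD[OF SV] by (intro measure_pmf.finite_measure_subadditive_finite) auto
    also have "\<dots> = (\<Sum>D\<in>?\<D> S. p ^ k)"
    proof (intro sum.cong refl)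
      fix D assume D: "D \<in> ?\<D> S"
      then have "D \<subseteq> all_edges V" using SV by (auto simp: all_edges_def)
      then show "measure_pmf.prob ?M {F. D \<subseteq> F} = p ^ k"
        using prob_superset[OF finite_all_edges[OF fV] _ p, of D] D by auto
    qed
    also have "\<dots> = real (card (all_edges S) choose k) * p ^ k"
      using n_subsets[OF finite_all_edges[OF finS[OF SV]], of k] by simp
    also have "\<dots> \<le> real (t ^ 2 choose k) * p ^ k"
      using card_all_edges_le[OF finS[OF SV]] S p
      by (intro mult_right_mono) (auto intro!: binomial_right_mono)
    finally show "measure_pmf.prob ?M (\<Union>D\<in>?\<D> S. {F. D \<subseteq> F}) \<le> real (t ^ 2 choose k) * p ^ k" .
  qed
  also have "\<dots> = real (card V choose t) * (real (t ^ 2 choose k) * p ^ k)"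
    using n_subsets[OF fV, of t] by simp
  finally show ?thesis .
qed

text \<open>\<open>k\<close> is the least integer above \<open>(1 + 1 / s) * t\<close>. The powers
  of \<open>n\<close> and \<open>t\<close> cancel up to \<open>z ^ d\<close> with
  \<open>z = t / n\<close> and \<open>d = k - t\<close>; everything else is at most
  \<open>K ^ t\<close>, because \<open>t + k \<le> 4 * t\<close> and
  \<open>k \<le> 3 * t\<close>.\<close>

lemma sparse_term_bound:
  fixes c :: real
  assumes s: "s \<ge> 1" and c: "c \<ge> 1" and t: "1 \<le> t" "t \<le> n" and n: "c \<le> real n"
    and K: "K = exp 4 * c ^ 3" and tn: "real t \<le> (1 / (2 * K)) ^ (2 * s) * real n"
  defines "k \<equiv> t + t div s + 1"
  shows "real (n choose t) * (real (t ^ 2 choose k) * (c / real n) ^ k) \<le> real t / 2 ^ t / sqrt (real n)"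
proof -
  define z where "z = real t / real n"
  define d where "d = t div s + 1"
  have kd: "k = t + d" by (simp add: k_def d_def)
  have dt: "d \<le> t + 1" unfolding d_def by simp
  then have k3: "k \<le> 3 * t" using t kd by linarith
  have sd: "t \<le> s * d"
  proof -
    have "t = s * (t div s) + t mod s" by simp
    also have "\<dots> \<le> s * (t div s) + s" using s by (intro add_left_mono less_imp_le mod_less_divisor) simp
    finally show ?thesis by (simp add: d_def)
  qed
  have np: "real n > 0" and tp: "real t > 0" using t by auto
  have z: "0 < z" "z \<le> 1" using t by (auto simp: z_def)
  have K1: "1 \<le> K"
  proof -
    have "1 \<le> c ^ 3" using c by (rule one_le_power)
    moreover have "1 \<le> exp (4::real)" by simp
    ultimately show ?thesis unfolding K using mult_mono[of 1 "exp 4" 1 "c ^ 3"] by simp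
  qed
  have b1: "real (n choose t) \<le> exp (real t) * (1 / z) ^ t"
  proof -
    have "real (n choose t) \<le> exp (real t) * real n ^ t / real t ^ t"
      using binomial_power_bound[of n t] tp by (simp add: pos_le_divide_eq)
    then show ?thesis by (simp add: z_def power_divide)
  qed
  have b2: "real (t ^ 2 choose k) \<le> (exp 1 * real t) ^ k"
  proof -
    have "real (t ^ 2 choose k) * real k ^ k \<le> exp (real k) * real (t ^ 2) ^ k"
      by (rule binomial_power_bound)
    moreover have "real t ^ k \<le> real k ^ k" using kd by (intro power_mono) auto
    ultimately have "real (t ^ 2 choose k) * real t ^ k \<le> exp (real k) * real (t ^ 2) ^ k"
      by (meson dual_order.trans mult_left_mono of_nat_0_le_iff)
    also have "exp (real k) * real (t ^ 2) ^ k = (exp 1 * real t) ^ k * real t ^ k"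
      by (simp add: power_mult_distrib power2_eq_square exp_of_nat_mult[symmetric])
    finally show ?thesis using tp by simp
  qed
  have "real (n choose t) * (real (t ^ 2 choose k) * (c / real n) ^ k)
      \<le> (exp (real t) * (1 / z) ^ t) * ((exp 1 * real t) ^ k * (c / real n) ^ k)"
    using b1 b2 c by (intro mult_mono) (auto intro!: mult_nonneg_nonneg)
  also have "(exp 1 * real t) ^ k * (c / real n) ^ k = exp (real k) * c ^ k * z ^ k"
    by (simp add: power_mult_distrib[symmetric] z_def exp_of_nat_mult[symmetric] power_divide mult_ac)
       (simp add: power_mult_distrib power_divide exp_of_nat_mult[symmetric])
  also have "(exp (real t) * (1 / z) ^ t) * (exp (real k) * c ^ k * z ^ k) = exp (real t + real k) * c ^ k * z ^ d"
  proof -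
    have "(1 / z) ^ t * z ^ t = 1" using z by (simp add: power_mult_distrib[symmetric])
    moreover have "z ^ k = z ^ t * z ^ d" by (simp add: kd power_add)
    ultimately show ?thesis by (simp add: exp_add mult_ac)
  qed
  also have "\<dots> \<le> K ^ t * z ^ d"
  proof (intro mult_right_mono)
    have "exp (real t + real k) \<le> exp (real t * 4)" using k3 by simp
    moreover have "c ^ k \<le> c ^ (3 * t)" using k3 c by (intro power_increasing) auto
    ultimately have "exp (real t + real k) * c ^ k \<le> exp (real t * 4) * c ^ (3 * t)"
      using c by (intro mult_mono) auto
    also have "\<dots> = K ^ t" unfolding K by (simp add: power_mult_distrib exp_of_nat_mult power_mult)
    finally show "exp (real t + real k) * c ^ k \<le> K ^ t" .
  qed (use z in auto)
  also have "\<dots> \<le> K ^ t * (sqrt z * (1 / (2 * K)) ^ t)"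
  proof (intro mult_left_mono)
    have sz: "0 \<le> sqrt z" "sqrt z \<le> 1" using z by auto
    have zs: "sqrt z \<le> (1 / (2 * K)) ^ s"
    proof -
      have "z \<le> (1 / (2 * K)) ^ (2 * s)" using tn np by (simp add: z_def pos_divide_le_eq)
      also have "\<dots> = ((1 / (2 * K)) ^ s)\<^sup>2" by (simp add: power_mult[symmetric] mult.commute)
      finally have "sqrt z \<le> sqrt (((1 / (2 * K)) ^ s)\<^sup>2)" by (rule real_sqrt_le_mono)
      then show ?thesis using K1 by simp
    qed
    \<comment> \<open>Of the \<open>2 * d\<close> factors \<open>sqrt z\<close>, one is kept for the
      decay in \<open>n\<close>, and \<open>d\<close> of them pay for \<open>(2 * K) ^ t\<close>
      because \<open>s * d \<ge> t\<close>; this dictates the exponent \<open>2 * s\<close> in the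
      bound on \<open>t / n\<close>.\<close>
    have "z ^ d = sqrt z ^ (2 * d)" using z by (simp add: power_mult)
    also have "\<dots> \<le> sqrt z ^ (d + 1)" using sz by (intro power_decreasing) (auto simp: d_def)
    also have "\<dots> = sqrt z * sqrt z ^ d" by simp
    also have "\<dots> \<le> sqrt z * ((1 / (2 * K)) ^ s) ^ d"
      using zs sz by (intro mult_left_mono power_mono) auto
    also have "\<dots> = sqrt z * (1 / (2 * K)) ^ (s * d)" by (simp add: power_mult)
    also have "\<dots> \<le> sqrt z * (1 / (2 * K)) ^ t"
      using sd K1 sz by (intro mult_left_mono power_decreasing) auto
    finally show "z ^ d \<le> sqrt z * (1 / (2 * K)) ^ t" .
  qed (use K1 in auto)
  also have "\<dots> = sqrt z / 2 ^ t" using K1 by (simp add: power_divide power_mult_distrib)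
  also have "\<dots> \<le> real t / 2 ^ t / sqrt (real n)"
  proof -
    have "sqrt (real t) \<le> real t" using t(1) by (intro real_le_lsqrt) (auto simp: power2_eq_square)
    then have "sqrt (real t) / 2 ^ t / sqrt (real n) \<le> real t / 2 ^ t / sqrt (real n)"
      using np by (intro divide_right_mono) auto
    then show ?thesis by (simp add: z_def real_sqrt_divide field_simps)
  qed
  finally show ?thesis .
qed

lemma sum_geometric_weighted: "(\<Sum>t=1..m. real t / 2 ^ t) \<le> 2"
proof -
  have "(\<Sum>t=1..m. real t / 2 ^ t) = 2 - (real m + 2) / 2 ^ m"
    by (induction m) (auto simp: field_simps)
  then show ?thesis by simp
qed

lemma gnp_sparse:
  fixes c :: real
  assumes c: "c > 0" and s: "s \<ge> 1"
  shows "\<exists>\<epsilon>>0. \<epsilon> \<le> 1 \<and> (\<lambda>n. measure_pmf.prob (gnp n (c / real n))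
     {F. \<exists>S\<subseteq>{1..n}. real (card S) \<le> \<epsilon> * real n \<and> (s + 1) * card S < s * edges_in F S}) \<longlonglongrightarrow> 0"
proof -
  \<comment> \<open>The term bound enlarges exponents of \<open>c\<close>, which requires a base of
    at least 1.\<close>
  define c' where "c' = max 1 c"
  define K where "K = exp 4 * c' ^ 3"
  define \<epsilon> where "\<epsilon> = (1 / (2 * K)) ^ (2 * s)"
  have c': "c' \<ge> 1" "c \<le> c'" by (auto simp: c'_def)
  have "1 * 1 \<le> exp 4 * c' ^ 3" using c' by (intro mult_mono) auto
  then have K1: "K \<ge> 1" by (simp add: K_def)
  have "0 < 1 / (2 * K)" "1 / (2 * K) \<le> 1" using K1 by (auto simp: field_simps)
  then have \<epsilon>: "\<epsilon> > 0" "\<epsilon> \<le> 1" unfolding \<epsilon>_def by (simp, intro power_le_one) auto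
  let ?P = "\<lambda>n. measure_pmf.prob (gnp n (c / real n))
     {F. \<exists>S\<subseteq>{1..n}. real (card S) \<le> \<epsilon> * real n \<and> (s + 1) * card S < s * edges_in F S}"
  have bound: "?P n \<le> 2 / sqrt (real n)" if n: "c' \<le> real n" for n
  proof -
    let ?m = "nat \<lfloor>\<epsilon> * real n\<rfloor>"
    let ?k = "\<lambda>t. t + t div s + 1"
    let ?p = "c / real n"
    let ?M = "rand_subset (all_edges {1..n}) ?p"
    have np: "real n > 0" using n c' by linarith
    have p: "0 \<le> ?p" "?p \<le> 1" using c n c' np by (auto simp: divide_simps)
    have "?P n \<le> measure_pmf.prob ?M (\<Union>t\<in>{1..?m}. {F. \<exists>S\<subseteq>{1..n}. card S = t \<and> ?k t \<le> edges_in F S})"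
      unfolding gnp_rand_subset
    proof (rule prob_rand_subset_mono)
      fix F assume "F \<in> {F. \<exists>S\<subseteq>{1..n}. real (card S) \<le> \<epsilon> * real n \<and> (s + 1) * card S < s * edges_in F S}"
        and FA: "F \<subseteq> all_edges {1..n}"
      then obtain S where S: "S \<subseteq> {1..n}" "real (card S) \<le> \<epsilon> * real n" "(s + 1) * card S < s * edges_in F S"
        by auto
      have "card S \<noteq> 0"
      proof
        assume "card S = 0"
        then have "S = {}" using S(1) finite_subset by fastforce
        moreover have "{e \<in> F. e \<subseteq> {}} = {}" using FA by (auto simp: all_edges_def)
        ultimately have "edges_in F S = 0" unfolding edges_in_def by (metis card.empty)
        then show False using S(3) by simp
      qed
      moreover have "card S \<le> ?m" using S(2) by (simp add: le_nat_floor)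
      moreover have "?k (card S) \<le> edges_in F S"
      proof (rule ccontr)
        assume "\<not> ?thesis"
        then have "edges_in F S \<le> card S + card S div s" by simp
        then have "s * edges_in F S \<le> s * (card S + card S div s)" by (rule mult_left_mono) simp
        also have "\<dots> \<le> s * card S + card S" by (simp add: distrib_left)
        finally show False using S(3) by simp
      qed
      ultimately show "F \<in> (\<Union>t\<in>{1..?m}. {F. \<exists>S\<subseteq>{1..n}. card S = t \<and> ?k t \<le> edges_in F S})"
        using S(1) by (intro UN_I[of "card S"]) auto
    qed
    also have "\<dots> \<le> (\<Sum>t=1..?m. measure_pmf.prob ?M {F. \<exists>S\<subseteq>{1..n}. card S = t \<and> ?k t \<le> edges_in F S})"
      by (intro measure_pmf.finite_measure_subadditive_finite) auto
    also have "\<dots> \<le> (\<Sum>t=1..?m. real t / 2 ^ t / sqrt (real n))"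
    proof (intro sum_mono)
      fix t assume t: "t \<in> {1..?m}"
      have "real t \<le> real ?m" using t by simp
      also have "\<dots> \<le> \<epsilon> * real n" using \<epsilon> by (intro of_nat_floor) simp
      finally have te: "real t \<le> \<epsilon> * real n" .
      also have "\<dots> \<le> 1 * real n" using \<epsilon> by (intro mult_right_mono) auto
      finally have tn: "t \<le> n" by simp
      have "measure_pmf.prob ?M {F. \<exists>S\<subseteq>{1..n}. card S = t \<and> ?k t \<le> edges_in F S}
          \<le> real (n choose t) * (real (t ^ 2 choose ?k t) * ?p ^ ?k t)"
        using prob_dense_sets_le[of "{1..n}" ?p t "?k t"] p by simp
      also have "\<dots> \<le> real (n choose t) * (real (t ^ 2 choose ?k t) * (c' / real n) ^ ?k t)"
        using c' p np by (intro mult_left_mono power_mono divide_right_mono) auto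
      also have "\<dots> \<le> real t / 2 ^ t / sqrt (real n)"
        using sparse_term_bound[OF s c'(1) _ tn n K_def] te t unfolding \<epsilon>_def by simp
      finally show "measure_pmf.prob ?M {F. \<exists>S\<subseteq>{1..n}. card S = t \<and> ?k t \<le> edges_in F S}
          \<le> real t / 2 ^ t / sqrt (real n)" .
    qed
    also have "\<dots> = (\<Sum>t=1..?m. real t / 2 ^ t) / sqrt (real n)" by (simp add: sum_divide_distrib)
    also have "\<dots> \<le> 2 / sqrt (real n)" by (intro divide_right_mono sum_geometric_weighted) auto
    finally show ?thesis .
  qed
  have "?P \<longlonglongrightarrow> 0"
  proof (rule tendsto_sandwich)
    show "\<forall>\<^sub>F n in sequentially. 0 \<le> ?P n" by simp
    show "\<forall>\<^sub>F n in sequentially. ?P n \<le> 2 / sqrt (real n)"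
      using eventually_ge_at_top[of "nat \<lceil>c'\<rceil>"] by eventually_elim (intro bound, linarith)
    show "(\<lambda>n. 2 / sqrt (real n)) \<longlonglongrightarrow> 0" by real_asymp
  qed simp
  then show ?thesis using \<epsilon> by blast
qed

section \<open>Counting good vertices\<close>

lemma bin_fail_nonneg:
  assumes "N' \<le> N" "0 \<le> p" "p \<le> 1"
  shows "0 \<le> bin_fail a N N' p"
  using prob_bin_fail[of "{..<N}" "{..<N'}" p a] assms
  by (metis (no_types) card_lessThan finite_lessThan lessThan_subset_iff measure_nonneg)

text \<open>Once the edges inside \<open>W\<close> are revealed, the edges between \<open>W\<close> and different vertices of \<open>R\<close> are
  still independent.\<close>

lemma fail_set_prob:
  fixes S M :: "'v set set \<Rightarrow> 'v set"
  assumes fV: "finite V" and WV: "W \<subseteq> V" and RV: "R \<subseteq> V" and RW: "R \<inter> W = {}"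
    and p: "0 \<le> p" "p \<le> 1" and N: "N' \<le> N"
    and SW: "\<And>F. S F \<subseteq> W" and MS: "\<And>F. M F \<subseteq> S F"
    and \<tau>: "measure_pmf.prob (rand_subset (all_edges V) p)
        {F. card (S (F \<inter> all_edges W)) < N \<or> card (M (F \<inter> all_edges W)) < N'} \<le> \<tau>"
  shows "measure_pmf.prob (rand_subset (all_edges V) p)
        {F. \<forall>v\<in>R. \<not> sat a (S (F \<inter> all_edges W)) (M (F \<inter> all_edges W)) (nbrs F v)}
      \<le> \<tau> + bin_fail a N N' p ^ card R"
proof -
  let ?A1 = "all_edges W" and ?A2 = "all_edges V - all_edges W"
  let ?q = "bin_fail a N N' p"
  define Z where "Z = {F. \<forall>v\<in>R. \<not> sat a (S (F \<inter> ?A1)) (M (F \<inter> ?A1)) (nbrs F v)}"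
  define Exc where "Exc = {X. card (S X) < N \<or> card (M X) < N'}"
  have sub: "?A1 \<subseteq> all_edges V" using WV by (auto simp: all_edges_def)
  have fA: "finite (all_edges V)" by (rule finite_all_edges[OF fV])
  have fin: "finite ?A1" "finite ?A2" using fA sub finite_subset by auto
  have fW: "finite W" and fR: "finite R" using fV WV RV finite_subset by blast+
  have q0: "0 \<le> ?q" by (rule bin_fail_nonneg[OF N p])
  have ExcP: "measure_pmf.prob (rand_subset ?A1 p) Exc \<le> \<tau>"
    using \<tau> prob_rand_subset_Int[OF fA sub, of p Exc] by (simp add: Exc_def)
  have "measure_pmf.prob (rand_subset (all_edges V) p) Z = measure_pmf.prob (rand_subset (?A1 \<union> ?A2) p) Z"
    using sub by (simp add: Un_absorb1)
  also have "\<dots> = measure_pmf.prob (pair_pmf (rand_subset ?A1 p) (rand_subset ?A2 p))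
      {(X, Y). X \<union> Y \<in> Z \<and> X \<subseteq> ?A1 \<and> Y \<subseteq> ?A2}"
    using fin by (intro prob_rand_subset_union) auto
  also have "\<dots> \<le> \<tau> + ?q ^ card R"
  proof (rule prob_pair_le[OF ExcP])
    show "0 \<le> ?q ^ card R" using q0 by simp
  next
    fix X assume X: "X \<in> set_pmf (rand_subset ?A1 p)" "X \<notin> Exc"
    have XA: "X \<subseteq> ?A1" using X(1) set_rand_subset by blast
    have fS: "finite (S X)" using SW fW finite_subset by blast
    \<comment> \<open>Outside \<open>Exc\<close> there are enough candidates. Cutting them down to
      exactly \<open>N\<close> and \<open>N'\<close> gives every vertex the same failure probability
      and can only make failure more likely.\<close>
    obtain M' where M': "M' \<subseteq> M X" "card M' = N'" "finite M'"
      using obtain_subset_with_card_n[of N' "M X"] X(2) unfolding Exc_def by force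
    have "\<exists>S'. M' \<subseteq> S' \<and> S' \<subseteq> S X \<and> card S' = N"
      using M' MS[of X] N X(2) fS by (intro exists_subset_between) (auto simp: Exc_def)
    then obtain S' where S': "M' \<subseteq> S'" "S' \<subseteq> S X" "card S' = N" by blast
    have fS': "finite S'" using S' fS finite_subset by blast
    \<comment> \<open>The possible edges from \<open>v\<close> to \<open>S'\<close>. As
      \<open>S'\<close> lies in \<open>W\<close> and \<open>R\<close> avoids \<open>W\<close>, these
      blocks are disjoint and none of their edges has been revealed.\<close>
    define blk where "blk v = (\<lambda>u. {u, v}) ` S'" for v
    define blk' where "blk' v = (\<lambda>u. {u, v}) ` M'" for v
    define U where "U = (\<Union>v\<in>R. blk v)"
    define Q where "Q v Y \<longleftrightarrow> \<not> (a < card (Y \<inter> blk v) \<or> a \<le> card (Y \<inter> blk' v))" for v Y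
    have inj: "inj_on (\<lambda>u. {u, v}) B" for v :: 'v and B by (auto simp: inj_on_def doubleton_eq_iff)
    have S'W: "S' \<subseteq> W" using S'(2) SW by blast
    have UA: "U \<subseteq> ?A2"
    proof
      fix e assume "e \<in> U"
      then obtain u v where uv: "v \<in> R" "u \<in> S'" "e = {u, v}" by (auto simp: U_def blk_def)
      then have "u \<in> W" "v \<notin> W" "v \<in> V" using S'W RW RV by auto
      then show "e \<in> ?A2" using uv WV by (auto simp: all_edges_def card_2_iff)
    qed
    have pr: "measure_pmf.prob (rand_subset U p) {Y. \<forall>v\<in>R. Q v (Y \<inter> blk v)} \<le> ?q ^ card R"
      unfolding U_def
    proof (rule prob_blocks[OF fR _ _ _ q0])
      show "finite (blk v)" for v using fS' by (simp add: blk_def)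
      show "blk v \<inter> blk w = {}" if "v \<in> R" "w \<in> R" "v \<noteq> w" for v w
        using that S'W RW by (auto simp: blk_def doubleton_eq_iff)
      show "measure_pmf.prob (rand_subset (blk v) p) {Y. Q v Y} \<le> ?q" for v
      proof -
        have "blk' v \<subseteq> blk v" using S'(1) by (auto simp: blk_def blk'_def)
        then have "measure_pmf.prob (rand_subset (blk v) p) {Y. Q v Y} = bin_fail a (card (blk v)) (card (blk' v)) p"
          unfolding Q_def using fS' p by (intro prob_bin_fail) (auto simp: blk_def)
        then show ?thesis using S'(3) M'(2) by (simp add: blk_def blk'_def card_image[OF inj])
      qed
    qed
    have "measure_pmf.prob (rand_subset ?A2 p) {Y. (X, Y) \<in> {(X, Y). X \<union> Y \<in> Z \<and> X \<subseteq> ?A1 \<and> Y \<subseteq> ?A2}}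
       \<le> measure_pmf.prob (rand_subset ?A2 p) {Y. Y \<inter> U \<in> {Y. \<forall>v\<in>R. Q v (Y \<inter> blk v)}}"
    proof (rule prob_rand_subset_mono)
      fix Y assume "Y \<in> {Y. (X, Y) \<in> {(X, Y). X \<union> Y \<in> Z \<and> X \<subseteq> ?A1 \<and> Y \<subseteq> ?A2}}"
      then have Y: "X \<union> Y \<in> Z" "Y \<subseteq> ?A2" by auto
      have XY: "(X \<union> Y) \<inter> ?A1 = X" using XA Y(2) by auto
      have "Q v (Y \<inter> U \<inter> blk v)" if v: "v \<in> R" for v
      proof -
        have ns: "\<not> sat a (S X) (M X) (nbrs (X \<union> Y) v)" using Y(1) v XY by (simp add: Z_def)
        have "Y \<inter> U \<inter> blk v \<inter> blk v \<subseteq> (\<lambda>u. {u, v}) ` (nbrs (X \<union> Y) v \<inter> S X)"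
          using S'(2) by (auto simp: blk_def nbrs_def)
        then have 1: "card (Y \<inter> U \<inter> blk v \<inter> blk v) \<le> card (nbrs (X \<union> Y) v \<inter> S X)"
          using fS by (meson card_image_le card_mono finite_Int finite_imageI le_trans)
        have "Y \<inter> U \<inter> blk v \<inter> blk' v \<subseteq> (\<lambda>u. {u, v}) ` (nbrs (X \<union> Y) v \<inter> M X)"
          using M'(1) by (auto simp: blk'_def nbrs_def)
        moreover have "finite (M X)" using MS fS finite_subset by blast
        ultimately have 2: "card (Y \<inter> U \<inter> blk v \<inter> blk' v) \<le> card (nbrs (X \<union> Y) v \<inter> M X)"
          by (meson card_image_le card_mono finite_Int finite_imageI le_trans)
        show ?thesis using 1 2 ns unfolding Q_def sat_def by linarith
      qed
      then show "Y \<in> {Y. Y \<inter> U \<in> {Y. \<forall>v\<in>R. Q v (Y \<inter> blk v)}}" by simp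
    qed
    also have "\<dots> = measure_pmf.prob (rand_subset U p) {Y. \<forall>v\<in>R. Q v (Y \<inter> blk v)}"
      by (rule prob_rand_subset_Int[OF fin(2) UA])
    also note pr
    finally show "measure_pmf.prob (rand_subset ?A2 p) {Y. (X, Y) \<in> {(X, Y). X \<union> Y \<in> Z \<and> X \<subseteq> ?A1 \<and> Y \<subseteq> ?A2}}
       \<le> ?q ^ card R" .
  qed
  finally show ?thesis by (simp add: Z_def)
qed

text \<open>Markov's inequality for the number of \<open>r\<close>-element subsets of a random set.\<close>

lemma subset_moment_bound:
  fixes M :: "'b pmf" and Bad :: "'b \<Rightarrow> 'v set"
  assumes fU: "finite U" and Bad: "\<And>F. F \<in> set_pmf M \<Longrightarrow> Bad F \<subseteq> U"
    and \<kappa>: "\<And>R. R \<subseteq> U \<Longrightarrow> card R = r \<Longrightarrow> measure_pmf.prob M {F. R \<subseteq> Bad F} \<le> \<kappa>"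
  shows "real (z choose r) * measure_pmf.prob M {F. z \<le> card (Bad F)} \<le> real (card U choose r) * \<kappa>"
proof -
  let ?R = "{R. R \<subseteq> U \<and> card R = r}"
  have fR: "finite ?R" by (rule finite_subset[of _ "Pow U"]) (use fU in auto)
  have "real (z choose r) * measure_pmf.prob M {F. z \<le> card (Bad F)}
      = measure_pmf.expectation M (\<lambda>F. real (z choose r) * indicator {F. z \<le> card (Bad F)} F)"
    by simp
  also have "\<dots> \<le> measure_pmf.expectation M (\<lambda>F. \<Sum>R\<in>?R. indicator {F. R \<subseteq> Bad F} F)"
  proof (intro integral_mono_AE)
    show "integrable (measure_pmf M) (\<lambda>F. real (z choose r) * indicator {F. z \<le> card (Bad F)} F)"
      by (intro integrable_mult_right integrable_real_indicator) (auto simp: measure_pmf.emeasure_eq_measure)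
    show "integrable (measure_pmf M) (\<lambda>F. \<Sum>R\<in>?R. indicator {F. R \<subseteq> Bad F} F :: real)"
      by (intro Bochner_Integration.integrable_sum integrable_real_indicator) (auto simp: measure_pmf.emeasure_eq_measure)
    show "AE F in measure_pmf M. real (z choose r) * indicator {F. z \<le> card (Bad F)} F
        \<le> (\<Sum>R\<in>?R. indicator {F. R \<subseteq> Bad F} F)"
      unfolding AE_measure_pmf_iff
    proof
      fix F assume F: "F \<in> set_pmf M"
      have fB: "finite (Bad F)" using Bad[OF F] fU finite_subset by blast
      have "(\<Sum>R\<in>?R. indicator {F. R \<subseteq> Bad F} F :: real) = (\<Sum>R\<in>?R. if R \<subseteq> Bad F then 1 else 0)"
        by (intro sum.cong) (auto simp: indicator_def)
      also have "\<dots> = real (card (?R \<inter> {R. R \<subseteq> Bad F}))" using fR by (simp add: sum.If_cases)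
      also have "?R \<inter> {R. R \<subseteq> Bad F} = {R. R \<subseteq> Bad F \<and> card R = r}" using Bad[OF F] by auto
      also have "card \<dots> = card (Bad F) choose r" by (rule n_subsets[OF fB])
      finally have eq: "(\<Sum>R\<in>?R. indicator {F. R \<subseteq> Bad F} F) = real (card (Bad F) choose r)" .
      show "real (z choose r) * indicator {F. z \<le> card (Bad F)} F \<le> (\<Sum>R\<in>?R. indicator {F. R \<subseteq> Bad F} F)"
        unfolding eq by (auto simp: indicator_def intro: binomial_right_mono)
    qed
  qed
  also have "\<dots> = (\<Sum>R\<in>?R. measure_pmf.prob M {F. R \<subseteq> Bad F})"
    by (subst Bochner_Integration.integral_sum)
      (auto intro!: integrable_real_indicator simp: measure_pmf.emeasure_eq_measure)
  also have "\<dots> \<le> (\<Sum>R\<in>?R. \<kappa>)" using \<kappa> by (intro sum_mono) auto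
  also have "\<dots> = real (card U choose r) * \<kappa>" using n_subsets[OF fU, of r] by simp
  finally show ?thesis .
qed

section \<open>Poisson limits and the abundance of good vertices\<close>

lemma binomial_limit:
  assumes "(\<lambda>n. real (N n) / real n) \<longlonglongrightarrow> x"
  shows "(\<lambda>n. real (N n choose i) / real n ^ i) \<longlonglongrightarrow> x ^ i / fact i"
proof (induction i)
  case (Suc i)
  have rec: "real (m choose Suc i) * real (Suc i) = real (m choose i) * (real m - real i)" for m
  proof -
    have "Suc i * (m choose Suc i) = (m - i) * (m choose i)"
      using binomial_absorption[of i m] binomial_absorb_comp[of m i] by simp
    then have "real (Suc i) * real (m choose Suc i) = real (m - i) * real (m choose i)"
      by (metis of_nat_mult)
    then show ?thesis by (cases "i \<le> m") (auto simp: of_nat_diff mult_ac binomial_eq_0)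
  qed
  have eq: "real (N n choose Suc i) / real n ^ Suc i =
      real (N n choose i) / real n ^ i * (real (N n) / real n - real i / real n) / real (Suc i)" for n
  proof -
    have "real (N n choose Suc i) = real (N n choose i) * (real (N n) - real i) / real (Suc i)"
      using rec[of "N n"] by (simp add: field_simps del: of_nat_Suc)
    then show ?thesis by (simp add: diff_divide_distrib[symmetric])
  qed
  have "(\<lambda>n. real i / real n) \<longlonglongrightarrow> 0" by real_asymp
  then have "(\<lambda>n. real (N n choose i) / real n ^ i * (real (N n) / real n - real i / real n) / real (Suc i))
      \<longlonglongrightarrow> x ^ i / fact i * (x - 0) / real (Suc i)"
    by (intro tendsto_intros Suc assms) auto
  moreover have "x ^ i / fact i * (x - 0) / real (Suc i) = x ^ Suc i / fact (Suc i)"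
    by (simp add: field_simps)
  ultimately show ?case unfolding eq by simp
qed simp

lemma pow_limit:
  fixes c :: real
  assumes "(\<lambda>n. real (K n) / real n) \<longlonglongrightarrow> x"
  shows "(\<lambda>n. (1 - c / real n) ^ K n) \<longlonglongrightarrow> exp (- c * x)"
proof -
  have "(\<lambda>n. real n * ln (1 - c / real n)) \<longlonglongrightarrow> - c" by real_asymp
  then have "(\<lambda>n. exp ((real (K n) / real n) * (real n * ln (1 - c / real n)))) \<longlonglongrightarrow> exp (x * - c)"
    by (intro tendsto_intros assms)
  moreover have "\<forall>\<^sub>F n in sequentially. exp ((real (K n) / real n) * (real n * ln (1 - c / real n))) = (1 - c / real n) ^ K n"
    using eventually_gt_at_top[of "nat \<lceil>\<bar>c\<bar>\<rceil>"]
  proof eventually_elim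
    case (elim n)
    then have n: "\<bar>c\<bar> < real n" "0 < n" by linarith+
    then have pos: "0 < 1 - c / real n" by (auto simp: field_simps)
    have "(real (K n) / real n) * (real n * ln (1 - c / real n)) = real (K n) * ln (1 - c / real n)"
      using n by simp
    then show ?case using pos by (simp add: exp_of_nat_mult)
  qed
  ultimately show ?thesis by (simp add: Lim_transform_eventually mult.commute)
qed

lemma diff_const_limit:
  assumes "(\<lambda>n. real (N n) / real n) \<longlonglongrightarrow> x"
  shows "(\<lambda>n. real (N n - i) / real n) \<longlonglongrightarrow> x"
proof (rule tendsto_sandwich)
  have "(\<lambda>n. real i / real n) \<longlonglongrightarrow> 0" by real_asymp
  then show "(\<lambda>n. real (N n) / real n - real i / real n) \<longlonglongrightarrow> x"
    using tendsto_diff[OF assms] by fastforce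
  show "\<forall>\<^sub>F n in sequentially. real (N n) / real n - real i / real n \<le> real (N n - i) / real n"
    by (intro always_eventually allI) (simp add: diff_divide_distrib[symmetric] divide_right_mono)
  show "\<forall>\<^sub>F n in sequentially. real (N n - i) / real n \<le> real (N n) / real n"
    by (intro always_eventually allI divide_right_mono) auto
qed (rule assms)

text \<open>The limit of \<open>bin_fail\<close>: there is a Poisson(\<open>l\<close>) number of
  good children, and \<open>m / l\<close> is the proportion of those with a smaller label.\<close>

definition poi_fail :: "nat \<Rightarrow> real \<Rightarrow> real \<Rightarrow> real" where
  "poi_fail a l m = (\<Sum>i\<le>a. exp (- l) * l ^ i / fact i) - exp (- l) * m ^ a / fact a"

lemma bin_fail_limit:
  assumes N: "(\<lambda>n. real (N n) / real n) \<longlonglongrightarrow> x" and N': "(\<lambda>n. real (N' n) / real n) \<longlonglongrightarrow> y"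
  shows "(\<lambda>n. bin_fail a (N n) (N' n) (c / real n)) \<longlonglongrightarrow> poi_fail a (c * x) (c * y)"
proof -
  have t: "(\<lambda>n. real (K n choose i) * (c / real n) ^ i * (1 - c / real n) ^ (N n - j)) \<longlonglongrightarrow>
      exp (- (c * x)) * (c * w) ^ i / fact i" if K: "(\<lambda>n. real (K n) / real n) \<longlonglongrightarrow> w" for K w i j
  proof -
    have "(\<lambda>n. real (K n choose i) / real n ^ i * c ^ i * (1 - c / real n) ^ (N n - j)) \<longlonglongrightarrow>
      w ^ i / fact i * c ^ i * exp (- c * x)"
      by (intro tendsto_intros binomial_limit[OF K] pow_limit[OF diff_const_limit[OF N]])
    then show ?thesis by (simp add: power_divide power_mult_distrib mult_ac)
  qed
  show ?thesis unfolding bin_fail_def poi_fail_def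
    by (intro tendsto_diff tendsto_sum t N N')
qed

text \<open>\<open>C\<close> is arbitrary because each level of the recursion deletes boundedly many
  further vertices. The threshold for \<open>n\<close> is uniform in \<open>W\<close>, so that the
  property applies to every set \<open>W - R\<close>.\<close>

definition abundant :: "real \<Rightarrow> real \<Rightarrow> (nat set set \<Rightarrow> nat set \<Rightarrow> nat \<Rightarrow> bool) \<Rightarrow> bool" where
  "abundant c z P \<longleftrightarrow> (\<forall>C. \<forall>\<tau>>0. \<forall>\<^sub>F n in sequentially. \<forall>W\<subseteq>{1..n}. n \<le> card W + C \<longrightarrow>
     measure_pmf.prob (gnp n (c / real n)) {F. real (card {v \<in> W. P F W v}) < z * real n} \<le> \<tau>)"

lemma ceiling_limit:
  "(\<lambda>n. real (nat \<lceil>x * real n\<rceil>) / real n) \<longlonglongrightarrow> x" if "0 \<le> x"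
proof (rule tendsto_sandwich)
  show "\<forall>\<^sub>F n in sequentially. x \<le> real (nat \<lceil>x * real n\<rceil>) / real n"
    using eventually_gt_at_top[of 0]
  proof eventually_elim
    case (elim n)
    have "x * real n \<le> real (nat \<lceil>x * real n\<rceil>)" by linarith
    then show ?case using elim by (simp add: pos_le_divide_eq)
  qed
  show "\<forall>\<^sub>F n in sequentially. real (nat \<lceil>x * real n\<rceil>) / real n \<le> x + 1 / real n"
    using eventually_gt_at_top[of 0]
  proof eventually_elim
    case (elim n)
    have "0 \<le> x * real n" using that by simp
    then have "real (nat \<lceil>x * real n\<rceil>) \<le> x * real n + 1" by linarith
    also have "\<dots> = (x + 1 / real n) * real n" using elim by (simp add: field_simps)
    finally show ?case using elim by (simp add: pos_divide_le_eq)
  qed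
  show "(\<lambda>n. x + 1 / real n) \<longlonglongrightarrow> x" by real_asymp
qed simp

lemma ceiling_minus_limit:
  fixes x :: real
  assumes "0 \<le> x"
  shows "(\<lambda>n. real (nat \<lceil>x * real n - real C\<rceil>) / real n) \<longlonglongrightarrow> x"
proof -
  have "nat \<lceil>x * real n - real C\<rceil> = nat \<lceil>x * real n\<rceil> - C" for n
  proof -
    have "\<lceil>x * real n - real C\<rceil> = \<lceil>x * real n\<rceil> - int C" by (metis ceiling_diff_of_int of_int_of_nat_eq)
    then show ?thesis by simp
  qed
  then show ?thesis using diff_const_limit[OF ceiling_limit[OF assms]] by simp
qed

lemma poi_fail_nonneg:
  assumes "c > 0" "0 \<le> y" "y \<le> x"
  shows "0 \<le> poi_fail a (c * x) (c * y)"
proof (rule tendsto_lowerbound)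
  show "(\<lambda>n. bin_fail a (nat \<lceil>x * real n\<rceil>) (nat \<lceil>y * real n\<rceil>) (c / real n)) \<longlonglongrightarrow> poi_fail a (c * x) (c * y)"
    by (intro bin_fail_limit ceiling_limit) (use assms in auto)
  show "\<forall>\<^sub>F n in sequentially. 0 \<le> bin_fail a (nat \<lceil>x * real n\<rceil>) (nat \<lceil>y * real n\<rceil>) (c / real n)"
    using eventually_ge_at_top[of "nat \<lceil>c\<rceil>"]
  proof eventually_elim
    case (elim n)
    then have "c \<le> real n" by linarith
    moreover have "nat \<lceil>y * real n\<rceil> \<le> nat \<lceil>x * real n\<rceil>"
      using assms by (intro nat_mono ceiling_mono mult_right_mono) auto
    ultimately show ?case using assms by (intro bin_fail_nonneg) auto
  qed
qed simp

text \<open>Given vertices \<open>R\<close>, \<open>r\<close> in number, all fail with probability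
  about \<open>q ^ r\<close>. Counting \<open>r\<close>-subsets of failing vertices, about
  \<open>\<theta> n\<close> failures have probability about \<open>(q / \<theta>) ^ r\<close>, which
  a large fixed \<open>r\<close> makes small. \<open>d\<close> is separate from \<open>a\<close>
  because roots need more children than other vertices.\<close>

lemma abundant_step:
  fixes c x y z :: real
  assumes c: "c > 0" and y: "0 \<le> y" "y \<le> x" and j: "j \<le> Suc L"
    and hx: "abundant c x (\<lambda>F W v. good F a L h L v W)"
    and hy: "j > 0 \<Longrightarrow> abundant c y (\<lambda>F W v. good F a L h (j - 1) v W)" and y0: "j = 0 \<Longrightarrow> y = 0"
    and z: "z + poi_fail d (c * x) (c * y) < 1"
  shows "abundant c z (\<lambda>F W v. sat d {u \<in> W - {v}. good F a L h L u (W - {v})}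
           {u \<in> W - {v}. j > 0 \<and> good F a L h (j - 1) u (W - {v})} (nbrs F v))"
  unfolding abundant_def
proof (intro allI impI)
  fix C and \<tau> :: real assume \<tau>: "\<tau> > 0"
  define q where "q = poi_fail d (c * x) (c * y)"
  define \<theta> where "\<theta> = 1 - z"
  have q0: "0 \<le> q" unfolding q_def by (rule poi_fail_nonneg[OF c y])
  have \<theta>: "0 < \<theta>" "q < \<theta>" using q0 z by (auto simp: \<theta>_def q_def)
  have "\<bar>q / \<theta>\<bar> < 1" using q0 \<theta> by simp
  then have "(\<lambda>r. (q / \<theta>) ^ r) \<longlonglongrightarrow> 0" by (intro LIMSEQ_power_zero) auto
  then have "\<forall>\<^sub>F r in sequentially. (q / \<theta>) ^ r < \<tau> / 4" using \<tau> by (intro order_tendstoD) auto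
  then obtain r where r: "(q / \<theta>) ^ r < \<tau> / 4" by (auto simp: eventually_sequentially)
  \<comment> \<open>Division by \<open>\<theta> ^ r\<close> turns the exceptional probability
    \<open>2 * \<tau>'\<close> into \<open>\<tau> / 4\<close>.\<close>
  define \<tau>' where "\<tau>' = \<tau> / 8 * \<theta> ^ r"
  have \<tau>': "\<tau>' > 0" using \<tau> \<theta> by (simp add: \<tau>'_def)
  define N where "N n = nat \<lceil>x * real n\<rceil>" for n
  define N' where "N' n = nat \<lceil>y * real n\<rceil>" for n
  \<comment> \<open>\<open>W\<close> may lack \<open>C\<close> vertices, so fewer than
    \<open>z n\<close> successes force only \<open>\<theta> n - C\<close> failures.\<close>
  define Z where "Z n = nat \<lceil>\<theta> * real n - real C\<rceil>" for n
  define \<kappa> where "\<kappa> n = 2 * \<tau>' + bin_fail d (N n) (N' n) (c / real n) ^ r" for n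
  have lim\<kappa>: "\<kappa> \<longlonglongrightarrow> 2 * \<tau>' + q ^ r"
    unfolding \<kappa>_def q_def N_def N'_def
    by (intro tendsto_intros bin_fail_limit ceiling_limit) (use y in auto)
  have limZ: "(\<lambda>n. real (Z n choose r) / real n ^ r) \<longlonglongrightarrow> \<theta> ^ r / fact r"
    unfolding Z_def by (intro binomial_limit ceiling_minus_limit) (use \<theta> in auto)
  have "(\<lambda>n. real n / real n) \<longlonglongrightarrow> 1" by real_asymp
  then have limn: "(\<lambda>n. real (n choose r) / real n ^ r) \<longlonglongrightarrow> 1 ^ r / fact r"
    by (intro binomial_limit)
  have lim: "(\<lambda>n. (real (n choose r) / real n ^ r) * \<kappa> n / (real (Z n choose r) / real n ^ r))
     \<longlonglongrightarrow> (1 ^ r / fact r) * (2 * \<tau>' + q ^ r) / (\<theta> ^ r / fact r)"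
    by (intro tendsto_intros limn lim\<kappa> limZ) (use \<theta> in auto)
  have eq: "(1 ^ r / fact r) * (2 * \<tau>' + q ^ r) / (\<theta> ^ r / fact r) = \<tau> / 4 + (q / \<theta>) ^ r"
    using \<theta> by (simp add: \<tau>'_def power_divide field_simps)
  have lt: "\<tau> / 4 + (q / \<theta>) ^ r < \<tau>" using r \<tau> by simp
  have ev1: "\<forall>\<^sub>F n in sequentially.
      (real (n choose r) / real n ^ r) * \<kappa> n / (real (Z n choose r) / real n ^ r) < \<tau>"
    by (rule order_tendstoD(2)[OF lim]) (simp only: eq lt)
  have ev2: "\<forall>\<^sub>F n in sequentially. 0 < real (Z n choose r) / real n ^ r"
    using order_tendstoD(1)[OF limZ, of 0] \<theta> by simp
  have ev3: "\<forall>\<^sub>F n in sequentially. \<forall>W\<subseteq>{1..n}. n \<le> card W + (C + r) \<longrightarrow>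
      measure_pmf.prob (gnp n (c / real n)) {F. real (card {v \<in> W. good F a L h L v W}) < x * real n} \<le> \<tau>'"
    using hx \<tau>' unfolding abundant_def by blast
  have ev4: "\<forall>\<^sub>F n in sequentially. j > 0 \<longrightarrow> (\<forall>W\<subseteq>{1..n}. n \<le> card W + (C + r) \<longrightarrow>
      measure_pmf.prob (gnp n (c / real n)) {F. real (card {v \<in> W. good F a L h (j - 1) v W}) < y * real n} \<le> \<tau>')"
  proof (cases "j > 0")
    case True
    then show ?thesis using hy[OF True] \<tau>' unfolding abundant_def by auto
  qed auto
  let ?P = "\<lambda>F W v. sat d {u \<in> W - {v}. good F a L h L u (W - {v})}
           {u \<in> W - {v}. j > 0 \<and> good F a L h (j - 1) u (W - {v})} (nbrs F v)"
  show "\<forall>\<^sub>F n in sequentially. \<forall>W\<subseteq>{1..n}. n \<le> card W + C \<longrightarrow>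
     measure_pmf.prob (gnp n (c / real n)) {F. real (card {v \<in> W. ?P F W v}) < z * real n} \<le> \<tau>"
    using ev1 ev2 ev3 ev4 eventually_ge_at_top[of "max 1 (nat \<lceil>c\<rceil>)"]
  proof eventually_elim
    case (elim n)
    show ?case
    proof (intro allI impI)
      fix W assume W: "W \<subseteq> {1..n}" and cW: "n \<le> card W + C"
      let ?V = "{1..n}" and ?p = "c / real n"
      let ?M = "rand_subset (all_edges ?V) ?p"
      have np: "real n > 0" and "c \<le> real n" using elim(5) by linarith+
      then have p: "0 \<le> ?p" "?p \<le> 1" using c by auto
      have fW: "finite W" using W finite_subset by blast
      define Bad where "Bad F = {v \<in> W. \<not> ?P F W v}" for F
      have le: "measure_pmf.prob ?M {F. real (card {v \<in> W. ?P F W v}) < z * real n}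
          \<le> measure_pmf.prob ?M {F. Z n \<le> card (Bad F)}"
      proof (rule measure_pmf.finite_measure_mono)
        show "{F. real (card {v \<in> W. ?P F W v}) < z * real n} \<subseteq> {F. Z n \<le> card (Bad F)}"
        proof
          fix F assume "F \<in> {F. real (card {v \<in> W. ?P F W v}) < z * real n}"
          then have F: "real (card {v \<in> W. ?P F W v}) < z * real n" by simp
          have "card W = card ({v \<in> W. ?P F W v} \<union> Bad F)"
            by (rule arg_cong[where f=card]) (auto simp: Bad_def)
          also have "\<dots> \<le> card {v \<in> W. ?P F W v} + card (Bad F)" by (rule card_Un_le)
          finally have "real n \<le> real (card {v \<in> W. ?P F W v}) + real (card (Bad F)) + real C"
            using cW by linarith
          then have "\<theta> * real n - real C \<le> real (card (Bad F))"
            using F by (simp add: \<theta>_def left_diff_distrib)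
          then show "F \<in> {F. Z n \<le> card (Bad F)}" unfolding Z_def by (simp add: ceiling_le_iff nat_le_iff)
        qed
      qed simp
      have mom: "real (Z n choose r) * measure_pmf.prob ?M {F. Z n \<le> card (Bad F)}
          \<le> real (card W choose r) * \<kappa> n"
      proof (rule subset_moment_bound[OF fW])
        show "Bad F \<subseteq> W" for F by (auto simp: Bad_def)
        fix R assume R: "R \<subseteq> W" "card R = r"
        \<comment> \<open>Deleting all of \<open>R\<close>, and not only \<open>v\<close>, makes
          failure more likely by monotonicity, but now the revealed edges are the same for every
          \<open>v\<close> in \<open>R\<close>. The hypotheses are therefore used with
          \<open>C + r\<close>.\<close>
        let ?W = "W - R"
        let ?S = "\<lambda>F. {u \<in> ?W. good F a L h L u ?W}"
        let ?T = "\<lambda>F. {u \<in> ?W. j > 0 \<and> good F a L h (j - 1) u ?W}"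
        have fR: "finite R" using R fW finite_subset by blast
        have cW': "n \<le> card ?W + (C + r)" using card_Diff_subset[OF fR R(1)] R(2) cW by linarith
        have W'V: "?W \<subseteq> ?V" using W by auto
        have loc: "?S (F \<inter> all_edges ?W) = ?S F" "?T (F \<inter> all_edges ?W) = ?T F" if F: "F \<subseteq> all_edges ?V" for F
        proof -
          have "good (F \<inter> all_edges ?W) a L h i u ?W \<longleftrightarrow> good F a L h i u ?W" if "u \<in> ?W" for i u
            by (rule good_cong) (use F that in \<open>auto simp: all_edges_def\<close>)
          then show "?S (F \<inter> all_edges ?W) = ?S F" "?T (F \<inter> all_edges ?W) = ?T F" by auto
        qed
        have "measure_pmf.prob ?M {F. R \<subseteq> Bad F} \<le> measure_pmf.prob ?M
            {F. \<forall>v\<in>R. \<not> sat d (?S (F \<inter> all_edges ?W)) (?T (F \<inter> all_edges ?W)) (nbrs F v)}"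
        proof (rule prob_rand_subset_mono)
          fix F assume RB: "F \<in> {F. R \<subseteq> Bad F}" and F: "F \<subseteq> all_edges ?V"
          have "\<not> sat d (?S F) (?T F) (nbrs F v)" if v: "v \<in> R" for v
          proof
            assume s: "sat d (?S F) (?T F) (nbrs F v)"
            have sub: "?W \<subseteq> W - {v}" using v by auto
            have g: "good F a L h i u (W - {v})" if "good F a L h i u ?W" for i u
              by (rule good_mono[OF that sub]) (use fW in simp)
            have "?P F W v"
              by (rule sat_mono[OF s]) (use g v fW in auto)
            then show False using RB v by (auto simp: Bad_def)
          qed
          then show "F \<in> {F. \<forall>v\<in>R. \<not> sat d (?S (F \<inter> all_edges ?W)) (?T (F \<inter> all_edges ?W)) (nbrs F v)}"
            using loc[OF F] by simp
        qed
        also have "\<dots> \<le> 2 * \<tau>' + bin_fail d (N n) (N' n) ?p ^ card R"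
        proof (rule fail_set_prob[OF _ W'V _ _ p])
          show "R \<subseteq> ?V" using R W by auto
          show "N' n \<le> N n" unfolding N_def N'_def
            using y by (intro nat_mono ceiling_mono mult_right_mono) auto
          show "?S F \<subseteq> ?W" for F by auto
          show "?T F \<subseteq> ?S F" for F
          proof
            fix u assume u: "u \<in> ?T F"
            then have "good F a L h L u ?W"
              using good_mono_label[of F a L h "j - 1" u ?W L] fW j by auto
            then show "u \<in> ?S F" using u by auto
          qed
          let ?E1 = "{F. real (card {v \<in> ?W. good F a L h L v ?W}) < x * real n}"
          let ?E2 = "{F. j > 0 \<and> real (card {v \<in> ?W. good F a L h (j - 1) v ?W}) < y * real n}"
          have "measure_pmf.prob ?M {F. card (?S (F \<inter> all_edges ?W)) < N n \<or> card (?T (F \<inter> all_edges ?W)) < N' n}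
              \<le> measure_pmf.prob ?M (?E1 \<union> ?E2)"
          proof (rule prob_rand_subset_mono)
            fix F assume "F \<in> {F. card (?S (F \<inter> all_edges ?W)) < N n \<or> card (?T (F \<inter> all_edges ?W)) < N' n}"
              and F: "F \<subseteq> all_edges ?V"
            then consider "card (?S F) < N n" | "card (?T F) < N' n" using loc[OF F] by auto
            then show "F \<in> ?E1 \<union> ?E2"
            proof cases
              case 1
              then have "real (card (?S F)) < x * real n" unfolding N_def by linarith
              then show ?thesis by simp
            next
              case 2
              then have lt: "real (card (?T F)) < y * real n" unfolding N'_def by linarith
              then have "j > 0" using y0 by (cases "j = 0") auto
              then show ?thesis using lt by simp
            qed
          qed
          also have "\<dots> \<le> measure_pmf.prob ?M ?E1 + measure_pmf.prob ?M ?E2"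
            by (rule measure_Un_le) auto
          also have "\<dots> \<le> \<tau>' + \<tau>'"
          proof (rule add_mono)
            show "measure_pmf.prob ?M ?E1 \<le> \<tau>'"
              using elim(3) W'V cW' unfolding gnp_rand_subset by blast
            show "measure_pmf.prob ?M ?E2 \<le> \<tau>'"
            proof (cases "j > 0")
              case True
              then show ?thesis using elim(4)[rule_format, OF True W'V cW'] unfolding gnp_rand_subset
                by (simp only: simp_thms)
            next
              case False
              then show ?thesis using \<tau>' by simp
            qed
          qed
          finally show "measure_pmf.prob ?M {F. card (?S (F \<inter> all_edges ?W)) < N n \<or> card (?T (F \<inter> all_edges ?W)) < N' n} \<le> 2 * \<tau>'"
            by simp
        qed auto
        finally show "measure_pmf.prob ?M {F. R \<subseteq> Bad F} \<le> \<kappa> n" by (simp add: \<kappa>_def R(2))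
      qed
      have "measure_pmf.prob ?M {F. Z n \<le> card (Bad F)} \<le> \<tau>"
      proof -
        have ch: "0 < real (Z n choose r)" using elim(2) by (auto simp: zero_less_divide_iff)
        have \<kappa>0: "0 \<le> \<kappa> n"
        proof -
          have "N' n \<le> N n" unfolding N_def N'_def
            using y by (intro nat_mono ceiling_mono mult_right_mono) auto
          then show ?thesis using bin_fail_nonneg[OF _ p] \<tau>' by (simp add: \<kappa>_def)
        qed
        have "card W \<le> n" using card_mono[OF _ W] by simp
        then have "real (card W choose r) * \<kappa> n \<le> real (n choose r) * \<kappa> n"
          using \<kappa>0 by (intro mult_right_mono) (auto intro: binomial_right_mono)
        with mom have "measure_pmf.prob ?M {F. Z n \<le> card (Bad F)} \<le> real (n choose r) * \<kappa> n / real (Z n choose r)"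
          using ch by (simp add: pos_le_divide_eq mult.commute)
        also have "\<dots> = (real (n choose r) / real n ^ r) * \<kappa> n / (real (Z n choose r) / real n ^ r)"
          using np by simp
        also have "\<dots> \<le> \<tau>" using elim(1) by simp
        finally show ?thesis .
      qed
      then show "measure_pmf.prob (gnp n ?p) {F. real (card {v \<in> W. ?P F W v}) < z * real n} \<le> \<tau>"
        using le unfolding gnp_rand_subset by (rule order_trans[rotated])
    qed
  qed
qed

text \<open>The densities \<open>min x ((j + 1) * \<delta>)\<close> are preserved from level to
  level: each label gains \<open>\<delta>\<close> until \<open>x\<close> is reached at
  \<open>L\<close>. Of the \<open>2 * \<delta>\<close> in the inequality, the other
  \<open>\<delta>\<close> is the strict slack that \<open>abundant_step\<close> asks for. At level 0
  every vertex is good, and \<open>x < 1\<close> absorbs the \<open>C\<close> missing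
  vertices.\<close>

lemma abundant_good:
  fixes c x \<delta> :: real
  assumes c: "c > 0" and x: "0 < x" "x < 1" and \<delta>: "\<delta> > 0"
    and ineq: "\<And>y. 0 \<le> y \<Longrightarrow> y \<le> x \<Longrightarrow> y + 2 * \<delta> \<le> 1 - poi_fail a (c * x) (c * y)"
    and L: "x \<le> (real L + 1) * \<delta>" and j: "j \<le> L"
  shows "abundant c (min x ((real j + 1) * \<delta>)) (\<lambda>F W v. good F a L h j v W)"
  using j
proof (induction h arbitrary: j)
  case 0
  show ?case unfolding abundant_def
  proof (intro allI impI)
    fix C and \<tau> :: real assume \<tau>: "\<tau> > 0"
    define y where "y = min x ((real j + 1) * \<delta>)"
    have y: "y < 1" using x by (simp add: y_def)
    show "\<forall>\<^sub>F n in sequentially. \<forall>W\<subseteq>{1..n}. n \<le> card W + C \<longrightarrow>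
      measure_pmf.prob (gnp n (c / real n)) {F. real (card {v \<in> W. good F a L 0 j v W}) < min x ((real j + 1) * \<delta>) * real n} \<le> \<tau>"
      using eventually_ge_at_top[of "nat \<lceil>real C / (1 - y)\<rceil>"]
    proof eventually_elim
      case (elim n)
      then have "real C / (1 - y) \<le> real n" by linarith
      then have "real C \<le> real n * (1 - y)" using y by (simp add: pos_divide_le_eq)
      then have n: "y * real n \<le> real n - real C" by (simp add: right_diff_distrib mult.commute)
      show ?case
      proof (intro allI impI)
        fix W :: "nat set" assume "n \<le> card W + C"
        then have "\<not> real (card W) < y * real n" using n by linarith
        then show "measure_pmf.prob (gnp n (c / real n)) {F. real (card {v \<in> W. good F a L 0 j v W}) < min x ((real j + 1) * \<delta>) * real n} \<le> \<tau>"
          using \<tau> by (simp add: y_def[symmetric])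
      qed
    qed
  qed
next
  case (Suc h)
  have xL: "min x ((real L + 1) * \<delta>) = x" using L by simp
  define y where "y = (if j = 0 then 0 else min x ((real (j - 1) + 1) * \<delta>))"
  have y: "0 \<le> y" "y \<le> x" using x \<delta> by (auto simp: y_def)
  have step: "min x ((real j + 1) * \<delta>) \<le> y + \<delta>"
    using \<delta> x by (cases j) (auto simp: y_def min_def algebra_simps)
  have "abundant c (min x ((real j + 1) * \<delta>)) (\<lambda>F W v. sat a {u \<in> W - {v}. good F a L h L u (W - {v})}
           {u \<in> W - {v}. j > 0 \<and> good F a L h (j - 1) u (W - {v})} (nbrs F v))"
  proof (rule abundant_step[OF c y])
    show "j \<le> Suc L" using Suc.prems by simp
    show "abundant c x (\<lambda>F W v. good F a L h L v W)" using Suc.IH[of L] xL by simp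
    show "abundant c y (\<lambda>F W v. good F a L h (j - 1) v W)" if "j > 0"
      using Suc.IH[of "j - 1"] Suc.prems that by (simp add: y_def)
    show "y = 0" if "j = 0" using that by (simp add: y_def)
    show "min x ((real j + 1) * \<delta>) + poi_fail a (c * x) (c * y) < 1"
      using ineq[OF y] step \<delta> by linarith
  qed
  then show ?case by simp
qed

text \<open>This makes the density of roots positive: without children of smaller label, success
  means more than \<open>d\<close> children.\<close>

lemma poi_fail_less_1:
  assumes "l > 0" "d > 0"
  shows "poi_fail d l 0 < 1"
proof -
  have e: "(\<lambda>n. l ^ n /\<^sub>R fact n) sums exp l" by (rule exp_converges)
  have "(\<Sum>i<Suc d. l ^ i /\<^sub>R fact i) < (\<Sum>i. l ^ i /\<^sub>R fact i)"
    by (rule sum_less_suminf[OF sums_summable[OF e]]) (use assms in auto)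
  then have "(\<Sum>i\<le>d. l ^ i / fact i) < exp l"
    using sums_unique[OF e] by (simp add: lessThan_Suc_atMost divide_inverse mult.commute)
  then have "exp (- l) * (\<Sum>i\<le>d. l ^ i / fact i) < exp (- l) * exp l" by simp
  then show ?thesis using assms by (simp add: poi_fail_def sum_distrib_left exp_minus power_0_left)
qed

section \<open>Above the core threshold\<close>

text \<open>The probability that a Poisson(\<open>l\<close>) variable is at least \<open>m\<close>,
  in a form that is smooth also at \<open>l = 0\<close>.\<close>

definition poi_tail :: "nat \<Rightarrow> real \<Rightarrow> real" where
  "poi_tail m l = 1 - (\<Sum>i<m. exp (- l) * l ^ i / fact i)"

lemma prob_poisson_tail:
  assumes "r \<ge> 0" "m \<ge> 1"
  shows "measure_pmf.prob (poisson_dist r) {j. j \<ge> m} = poi_tail m r"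
proof (cases "r = 0")
  case True
  have "(\<Sum>i<m. exp (- r) * r ^ i / fact i) = (\<Sum>i\<in>{0}. exp (- r) * r ^ i / fact i)"
    using True assms(2) by (intro sum.mono_neutral_right) auto
  then show ?thesis using True assms(2) by (simp add: poisson_dist_def poi_tail_def)
next
  case False
  then have r: "r > 0" using assms by simp
  have "measure_pmf.prob (poisson_pmf r) {j. j \<ge> m} = measure_pmf.prob (poisson_pmf r) (UNIV - {..<m})"
    by (rule arg_cong[where f="measure_pmf.prob _"]) auto
  also have "\<dots> = 1 - measure_pmf.prob (poisson_pmf r) {..<m}"
    by (subst measure_pmf.finite_measure_Diff) auto
  also have "measure_pmf.prob (poisson_pmf r) {..<m} = (\<Sum>i<m. exp (- r) * r ^ i / fact i)"
    using r by (subst measure_measure_pmf_finite) (auto simp: mult.commute)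
  finally show ?thesis using False by (simp add: poisson_dist_def poi_tail_def)
qed

lemma poi_tail_deriv:
  "(poi_tail (Suc m) has_real_derivative exp (- l) * l ^ m / fact m) (at l)"
proof (induction m)
  case 0
  show ?case unfolding poi_tail_def by (auto intro!: derivative_eq_intros)
next
  case (Suc m)
  have eq: "poi_tail (Suc (Suc m)) = (\<lambda>l. poi_tail (Suc m) l - exp (- l) * l ^ Suc m / fact (Suc m))"
    by (auto simp: poi_tail_def fun_eq_iff)
  have "((\<lambda>l. exp (- l) * l ^ Suc m / fact (Suc m)) has_real_derivative
      (exp (- l) * (real (Suc m) * l ^ m) - exp (- l) * l ^ Suc m) / fact (Suc m)) (at l)"
    by (auto intro!: derivative_eq_intros simp del: fact_Suc power_Suc)
  moreover have "(exp (- l) * (real (Suc m) * l ^ m) - exp (- l) * l ^ Suc m) / fact (Suc m)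
     = exp (- l) * l ^ m / fact m - exp (- l) * l ^ Suc m / fact (Suc m)"
    by (simp add: diff_divide_distrib del: power_Suc)
  ultimately have d: "((\<lambda>l. exp (- l) * l ^ Suc m / fact (Suc m)) has_real_derivative
     exp (- l) * l ^ m / fact m - exp (- l) * l ^ Suc m / fact (Suc m)) (at l)" by simp
  show ?case unfolding eq using DERIV_diff[OF Suc d] by simp
qed

lemma poi_tail_less_1:
  assumes "m \<ge> 1" "l \<ge> 0" shows "poi_tail m l < 1"
proof -
  have "0 < exp (- l) * l ^ 0 / fact 0" by simp
  also have "\<dots> \<le> (\<Sum>i<m. exp (- l) * l ^ i / fact i)"
    by (rule member_le_sum) (use assms in auto)
  finally show ?thesis by (simp add: poi_tail_def)
qed

lemma poi_tail_strict_mono: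
  assumes "m \<ge> 1" "0 < l" "l < l'" shows "poi_tail m l < poi_tail m l'"
proof -
  obtain m' where m: "m = Suc m'" using assms(1) by (cases m) auto
  show ?thesis unfolding m
    by (rule DERIV_pos_imp_increasing[OF assms(3)])
      (use assms(2) in \<open>auto intro!: exI poi_tail_deriv divide_pos_pos mult_pos_pos\<close>)
qed

lemma poi_tail_lim: "(poi_tail m \<longlongrightarrow> 1) at_top"
proof -
  have t: "((\<lambda>l::real. exp (- l) * l ^ i / fact i) \<longlongrightarrow> 0 / fact i) at_top" for i
  proof -
    have "((\<lambda>l::real. l ^ i / exp l / fact i) \<longlongrightarrow> 0 / fact i) at_top"
      by (intro tendsto_divide tendsto_power_div_exp_0 tendsto_const) auto
    moreover have "(\<lambda>l::real. exp (- l) * l ^ i / fact i) = (\<lambda>l. l ^ i / exp l / fact i)"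
      by (auto simp: fun_eq_iff exp_minus divide_inverse)
    ultimately show ?thesis by (simp only:)
  qed
  have "((\<lambda>l::real. 1 - (\<Sum>i<m. exp (- l) * l ^ i / fact i)) \<longlongrightarrow> 1 - (\<Sum>i<m. 0 / fact i)) at_top"
    by (intro tendsto_diff tendsto_const tendsto_sum t)
  then show ?thesis by (simp add: poi_tail_def[abs_def])
qed

text \<open>\<open>GREATEST\<close> over the reals is informative only if a maximum exists; here the
  fixed points form a compact set that contains 0.\<close>

lemma core_beta_fixpoint:
  assumes "m \<ge> 1" "c > 0"
  shows "core_beta (Suc m) c \<in> {0..1}" "core_beta (Suc m) c = poi_tail m (c * core_beta (Suc m) c)"
    "\<And>x. x \<in> {0..1} \<Longrightarrow> x = poi_tail m (c * x) \<Longrightarrow> x \<le> core_beta (Suc m) c"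
proof -
  define P where "P x \<longleftrightarrow> x \<in> {0..1} \<and> x = measure_pmf.prob (poisson_dist (c * x)) {j. j \<ge> Suc m - 1}" for x
  have P: "P x \<longleftrightarrow> x \<in> {0..1} \<and> x = poi_tail m (c * x)" for x
    using prob_poisson_tail[of "c * x" m] assms unfolding P_def by (cases "0 \<le> x") auto
  let ?S = "{x \<in> {0..1}. x - poi_tail m (c * x) = 0}"
  have "closed {x. x - poi_tail m (c * x) = 0}"
    unfolding poi_tail_def by (intro closed_Collect_eq continuous_intros) auto
  then have "compact ({0..1} \<inter> {x. x - poi_tail m (c * x) = 0})" by (intro compact_Int_closed) auto
  then have "compact ?S" by (simp add: Int_def)
  moreover have "0 \<in> ?S"
  proof -
    have "poi_tail m 0 = 0" using prob_poisson_tail[of 0 m] assms by (simp add: poisson_dist_def)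
    then show ?thesis by simp
  qed
  ultimately obtain g where g: "g \<in> ?S" "\<And>x. x \<in> ?S \<Longrightarrow> x \<le> g"
    using compact_attains_sup[of ?S] by blast
  have "core_beta (Suc m) c = g" unfolding core_beta_def P_def[symmetric]
    by (rule Greatest_equality) (use g P in auto)
  then show "core_beta (Suc m) c \<in> {0..1}" "core_beta (Suc m) c = poi_tail m (c * core_beta (Suc m) c)"
    "\<And>x. x \<in> {0..1} \<Longrightarrow> x = poi_tail m (c * x) \<Longrightarrow> x \<le> core_beta (Suc m) c"
    using g by auto
qed

text \<open>Rules out the infimum of an empty set in \<open>core_threshold\<close>.\<close>

lemma core_beta_pos_exists:
  assumes "m \<ge> 1" shows "\<exists>c>0. core_beta (Suc m) c > 0"
proof -
  have "\<forall>\<^sub>F l in at_top. 1 / 2 < poi_tail m l" using poi_tail_lim by (rule order_tendstoD) simp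
  then have "\<forall>\<^sub>F l in at_top. 1 / 2 < poi_tail m l \<and> (0::real) < l"
    using eventually_gt_at_top by (rule eventually_conj)
  then obtain l where l: "1 / 2 < poi_tail m l" "0 < l" using eventually_happens by fastforce
  define c where "c = 2 * l"
  have "continuous_on {1 / 2..1} (\<lambda>x. x - poi_tail m (c * x))"
    unfolding poi_tail_def by (intro continuous_intros) auto
  moreover have "1 / 2 - poi_tail m (c * (1 / 2)) \<le> 0" using l by (simp add: c_def)
  moreover have "0 \<le> 1 - poi_tail m (c * 1)" using poi_tail_less_1[OF assms, of c] l by (simp add: c_def)
  ultimately obtain x where x: "1 / 2 \<le> x" "x \<le> 1" "x - poi_tail m (c * x) = 0"
    using IVT'[of "\<lambda>x. x - poi_tail m (c * x)" "1 / 2" 0 1] by auto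
  then have "x \<le> core_beta (Suc m) c" using core_beta_fixpoint(3)[OF assms, of c x] l by (auto simp: c_def)
  then show ?thesis using x(1) l by (intro exI[of _ c]) (auto simp: c_def)
qed

text \<open>At a point \<open>x\<close> where \<open>f x - x\<close> is maximal, with \<open>f x = poi_tail m (c x)\<close>, the derivative of \<open>f\<close> is at
  most 1. This is what makes the vertices with exactly \<open>m\<close> good children subcritical.\<close>

lemma supercritical_point:
  assumes m: "m \<ge> 1" and c: "c > core_threshold (Suc m)"
  shows "c > 0 \<and> (\<exists>x \<delta>. 0 < x \<and> x < 1 \<and> 0 < \<delta> \<and>
    (\<forall>y. 0 \<le> y \<longrightarrow> y \<le> x \<longrightarrow> y + 2 * \<delta> \<le> 1 - poi_fail m (c * x) (c * y)))"
proof -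
  let ?C = "{c. c > 0 \<and> core_beta (Suc m) c > 0}"
  have ne: "?C \<noteq> {}" using core_beta_pos_exists[OF m] by auto
  then obtain c0 where c0: "c0 \<in> ?C" "c0 < c" using cInf_lessD[OF ne c[unfolded core_threshold_def]] by blast
  define \<beta> where "\<beta> = core_beta (Suc m) c0"
  have \<beta>: "0 < \<beta>" "\<beta> \<le> 1" "\<beta> = poi_tail m (c0 * \<beta>)"
    using c0 core_beta_fixpoint(1,2)[OF m, of c0] by (auto simp: \<beta>_def)
  have cp: "c > 0" using c0 by auto
  define g where "g x = poi_tail m (c * x) - x" for x
  \<comment> \<open>Raising the rate from \<open>c0\<close> to \<open>c\<close> strictly increases
    the tail at the fixed point \<open>\<beta>\<close> of \<open>c0\<close>.\<close>
  have g\<beta>: "0 < g \<beta>"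
    using poi_tail_strict_mono[OF m, of "c0 * \<beta>" "c * \<beta>"] c0 \<beta> by (simp add: g_def)
  have "continuous_on {\<beta>..1} g" unfolding g_def poi_tail_def by (intro continuous_intros) auto
  then obtain x where x: "x \<in> {\<beta>..1}" and max: "\<And>y. y \<in> {\<beta>..1} \<Longrightarrow> g y \<le> g x"
    using continuous_attains_sup[of "{\<beta>..1}" g] \<beta> by auto
  have gx: "0 < g x" using max[of \<beta>] g\<beta> \<beta> by auto
  have "g 1 < 0" using poi_tail_less_1[OF m, of c] cp by (simp add: g_def)
  then have x1: "x < 1" using gx x by (cases "x = 1") auto
  have x0: "0 < x" using x \<beta> by auto
  obtain m' where m': "m = Suc m'" using m by (cases m) auto
  define D where "D = c * (exp (- (c * x)) * (c * x) ^ m' / fact m')"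
  have dg: "(g has_real_derivative D - 1) (at x)"
  proof -
    have "((\<lambda>x. poi_tail m (c * x)) has_real_derivative (exp (- (c * x)) * (c * x) ^ m' / fact m') * c) (at x)"
      unfolding m' by (rule DERIV_chain2[OF poi_tail_deriv]) (auto intro!: derivative_eq_intros)
    then show ?thesis unfolding g_def D_def by (auto intro!: derivative_eq_intros)
  qed
  \<comment> \<open>The maximum may sit at the left end \<open>\<beta>\<close>, so only points to
    the right of \<open>x\<close> are compared; \<open>x < 1\<close> leaves room for them.\<close>
  have D: "D \<le> 1"
  proof (rule ccontr)
    assume "\<not> ?thesis"
    then obtain e where e: "e > 0" "\<And>h. 0 < h \<Longrightarrow> h < e \<Longrightarrow> g x < g (x + h)"
      using DERIV_pos_inc_right[OF dg] by auto
    define h where "h = min (e / 2) (1 - x)"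
    have "0 < h" "h < e" "x + h \<in> {\<beta>..1}" using e x1 x by (auto simp: h_def)
    then show False using e(2)[of h] max[of "x + h"] by simp
  qed
  \<comment> \<open>The probability of exactly \<open>m\<close> good children. The identity
    \<open>T * m = D * x\<close> turns \<open>D \<le> 1\<close> into the subcriticality of low
    vertices.\<close>
  define T where "T = exp (- (c * x)) * (c * x) ^ m / fact m"
  have T: "T * real m \<le> x"
  proof -
    have "fact m = real m * fact m'" by (simp add: m')
    then have "T * real m = exp (- (c * x)) * (c * x) ^ m / fact m'" using m by (simp add: T_def)
    also have "\<dots> = D * x" by (simp add: D_def m')
    also have "\<dots> \<le> 1 * x" using D x0 by (intro mult_right_mono) auto
    finally show ?thesis by simp
  qed
  have T0: "0 \<le> T" unfolding T_def using cp x0 by simp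
  \<comment> \<open>Replacing the label density \<open>x\<close> by \<open>y\<close> costs
    \<open>T * (1 - q ^ m)\<close>, by Bernoulli at most \<open>T * m * (1 - q)\<close> and thus at
    most \<open>x - y\<close>. What is left exceeds \<open>y\<close> by at least \<open>g x\<close>,
    so \<open>\<delta>\<close> is half of this.\<close>
  have "y + 2 * (g x / 2) \<le> 1 - poi_fail m (c * x) (c * y)" if y: "0 \<le> y" "y \<le> x" for y
  proof -
    define q where "q = y / x"
    have q: "0 \<le> q" "q \<le> 1" "y = q * x" using y x0 by (auto simp: q_def)
    have b: "1 + real m * (q - 1) \<le> q ^ m" using Bernoulli_inequality[of "q - 1" m] q by simp
    have "exp (- (c * x)) * (c * y) ^ m / fact m = T * q ^ m"
      by (simp add: T_def q power_mult_distrib)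
    moreover have "(\<Sum>i\<le>m. exp (- (c * x)) * (c * x) ^ i / fact i)
        = (\<Sum>i<m. exp (- (c * x)) * (c * x) ^ i / fact i) + T"
      by (simp add: T_def lessThan_Suc_atMost[symmetric])
    ultimately have "1 - poi_fail m (c * x) (c * y) = poi_tail m (c * x) - T + T * q ^ m"
      by (simp add: poi_fail_def poi_tail_def)
    also have "\<dots> \<ge> poi_tail m (c * x) - T + T * (1 + real m * (q - 1))"
      using b T0 by (intro add_left_mono mult_left_mono)
    also have "poi_tail m (c * x) - T + T * (1 + real m * (q - 1)) = poi_tail m (c * x) - T * real m * (1 - q)"
      by (simp add: algebra_simps)
    also have "\<dots> \<ge> poi_tail m (c * x) - x * (1 - q)"
      using T q by (intro diff_left_mono mult_right_mono) auto
    also have "x * (1 - q) = x - y" using q by (simp add: algebra_simps)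
    finally have "poi_tail m (c * x) - (x - y) \<le> 1 - poi_fail m (c * x) (c * y)" .
    moreover have "2 * (g x / 2) = poi_tail m (c * x) - x" by (simp add: g_def)
    ultimately show ?thesis by argo
  qed
  then show ?thesis using cp x0 x1 gx by (intro conjI exI[of _ x] exI[of _ "g x / 2"]) auto
qed

section \<open>Linear components\<close>

text \<open>The deterministic part. Some round loses at most \<open>card V / D\<close> vertices, and
  the two conditions on \<open>D\<close> keep \<open>s + 2\<close> times this number within
  \<open>m div 2\<close> and below the number of roots, as \<open>expanding_core\<close>
  requires.\<close>

lemma s_star_linear:
  fixes V :: "'v set" and \<epsilon> z :: real
  assumes fV: "finite V" and EV: "E \<subseteq> all_edges V" and b: "b \<ge> 1" and \<epsilon>: "\<epsilon> > 0"
    and s: "s = 3 * ((b + 2) ^ (L + 1) * (b + 3) + 1)"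
    and sparse: "\<And>S. S \<subseteq> V \<Longrightarrow> real (card S) \<le> \<epsilon> * real (card V) \<Longrightarrow> s * edges_in E S \<le> (s + 1) * card S"
    and D: "D > 0" "4 * real (s + 2) \<le> \<epsilon> * real D" "real (s + 2) < z * real D"
    and n: "4 \<le> \<epsilon> * real (card V)"
    and roots: "z * real (card V) \<le> real (card {r \<in> V. b + 3 \<le>
      card (nbrs E r \<inter> {u \<in> V - {r}. good E (b + 1) L (D * (L + 2)) L u (V - {r})})})"
  shows "\<epsilon> / 2 * real (card V) \<le> real (s_star b first V E)"
proof -
  let ?M = "(b + 2) ^ (L + 1)"
  define A where "A = peel E (b + 2) ?M V"
  let ?R = "{r \<in> V. b + 3 \<le> card (nbrs E r \<inter> {u \<in> V - {r}. good E (b + 1) L (D * (L + 2)) L u (V - {r})})}"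
  define m where "m = nat \<lfloor>\<epsilon> * real (card V)\<rfloor>"
  have m1: "real m \<le> \<epsilon> * real (card V)" unfolding m_def using n by (intro of_nat_floor) simp
  have m2: "\<epsilon> * real (card V) < real m + 1" unfolding m_def using n by linarith
  have V0: "0 < real (card V)" using n \<epsilon> by (cases "card V = 0") auto
  obtain d where d: "d < D" "D * card (A d - A (Suc d)) \<le> card V"
    using peel_pigeonhole[OF fV D(1)] unfolding A_def by blast
  define B where "B = A d - A (Suc d)"
  have B0: "real D * real (card B) \<le> real (card V)"
    using d(2) unfolding B_def by (metis of_nat_le_iff of_nat_mult)
  have D0: "0 < real D" using D(1) by simp
  have B1: "4 * (real (s + 2) * real (card B)) \<le> \<epsilon> * real (card V)"
  proof -
    have "(4 * real (s + 2)) * real (card B) \<le> (\<epsilon> * real D) * real (card B)"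
      using D(2) by (rule mult_right_mono) simp
    also have "\<dots> = \<epsilon> * (real D * real (card B))" by simp
    also have "\<dots> \<le> \<epsilon> * real (card V)" using B0 \<epsilon> by (intro mult_left_mono) auto
    finally show ?thesis by (simp only: mult.assoc)
  qed
  \<comment> \<open>The assumption \<open>4 \<le> \<epsilon> * card V\<close> absorbs the rounding
    in \<open>m\<close> and in \<open>m div 2\<close>.\<close>
  have "real ((s + 2) * card B) \<le> real m / 2 - 1 / 2"
    using B1 m2 n unfolding of_nat_mult by linarith
  then have Bm: "(s + 2) * card B \<le> m div 2" by linarith
  have "0 \<le> real (s + 2)" by simp
  then have "0 < z * real D" using D(3) by linarith
  then have z0: "0 < z" using D0 by (simp add: zero_less_mult_iff)
  have "real (s + 2) * real (card B) < z * real (card V)"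
  proof (cases "card B = 0")
    case True
    then show ?thesis using z0 V0 by simp
  next
    case False
    have "real (s + 2) * real (card B) < (z * real D) * real (card B)"
      using D(3) False by (intro mult_strict_right_mono) auto
    also have "\<dots> = z * (real D * real (card B))" by simp
    also have "\<dots> \<le> z * real (card V)" using B0 z0 by (intro mult_left_mono) auto
    finally show ?thesis .
  qed
  then have "real ((s + 2) * card B) < real (card ?R)" using roots unfolding of_nat_mult by linarith
  also have "card ?R \<le> card {v \<in> A d. b + 2 < deg E (A d) v}"
  proof (rule card_mono)
    have "A d \<subseteq> V" unfolding A_def by (rule peel_subset)
    then show "finite {v \<in> A d. b + 2 < deg E (A d) v}" using fV by (auto intro: finite_subset)
    have fA: "finite (A d)" using \<open>A d \<subseteq> V\<close> fV finite_subset by blast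
    \<comment> \<open>Roots survive all \<open>D\<close> rounds, hence also the first
      \<open>d\<close>, whichever round the pigeonhole picks.\<close>
    show "?R \<subseteq> {v \<in> A d. b + 2 < deg E (A d) v}"
    proof
      fix r assume r: "r \<in> ?R"
      interpret witness E "b + 1" L "D * (L + 2)" V r
        using r fV by unfold_locales auto
      have "r \<in> A D" "b + 3 \<le> deg E (A D) r" using root_in_peel[of D] unfolding A_def by (simp_all add: numeral_3_eq_3)
      moreover have "A D \<subseteq> A d" using d(1) unfolding A_def by (intro peel_antimono) simp
      ultimately show "r \<in> {v \<in> A d. b + 2 < deg E (A d) v}"
        using deg_mono[of "A D" "A d" E r] fA by auto
    qed
  qed
  finally have H: "(s + 2) * card B < card {v \<in> A d. b + 2 < deg E (A d) v}" by linarith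
  have "\<exists>K r. r \<in> K \<and> K \<subseteq> V \<and> (\<forall>T. T \<subseteq> K \<and> r \<in> T \<and> conn_from E r T \<and> card T \<le> m div 2 \<longrightarrow>
     b * card T < card (boundary E T (K - T)))"
  proof (rule expanding_core[OF fV EV _ _ _ _ _ _ Bm H])
    show "A d \<subseteq> V" unfolding A_def by (rule peel_subset)
    show "B \<subseteq> A d" unfolding B_def by auto
    show "b + 2 \<le> deg E (A d) v" "card (low_comp E (b + 2) (A d) v) \<le> ?M" if "v \<in> A d - B" for v
      using that unfolding B_def A_def by auto
    show "s * edges_in E S \<le> (s + 1) * card S" if "S \<subseteq> V" "card S \<le> m" for S
      using sparse[OF that(1)] that(2) m1 by linarith
    show "3 * (?M * (b + 3) + 1) \<le> s" using s by simp
  qed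
  then obtain K r where K: "r \<in> K" "K \<subseteq> V"
    and ex: "\<forall>T. T \<subseteq> K \<and> r \<in> T \<and> conn_from E r T \<and> card T \<le> m div 2 \<longrightarrow>
      b * card T < card (boundary E T (K - T))"
    by (elim exE conjE)
  have "maker_can_guarantee b first V E (m div 2 + 1)"
    by (rule maker_wins_if_expanding[OF fV EV K], rule ex[rule_format]) simp
  then have "m div 2 + 1 \<le> s_star b first V E" by (rule s_star_ge[OF fV EV b])
  moreover have "\<epsilon> / 2 * real (card V) \<le> real (m div 2 + 1)" using m2 by linarith
  ultimately show ?thesis by linarith
qed

theorem theorem2:
  fixes b :: nat and c :: real
  assumes "b \<ge> 1" and "c > core_threshold (b + 2)"
  shows "\<exists>\<epsilon>>0. \<forall>first.
    (\<lambda>n. measure_pmf.prob (gnp n (c / real n))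
           {E. real (s_star b first {1..n} E) \<ge> \<epsilon> * real n}) \<longlonglongrightarrow> 1"
proof -
  obtain x \<delta> where c: "c > 0" and x: "0 < x" "x < 1" and \<delta>: "0 < \<delta>"
    and ineq: "\<And>y. 0 \<le> y \<Longrightarrow> y \<le> x \<Longrightarrow> y + 2 * \<delta> \<le> 1 - poi_fail (b + 1) (c * x) (c * y)"
    using supercritical_point[of "b + 1" c] assms(2) by auto
  obtain L :: nat where "x / \<delta> < real L" using reals_Archimedean2 by blast
  then have L: "x \<le> (real L + 1) * \<delta>" using \<delta> by (simp add: pos_divide_less_eq field_simps)
  \<comment> \<open>The failure probability of a root, which needs \<open>b + 3\<close> children: at
    label 0 the second alternative of \<open>sat\<close> is void, hence the argument 0.\<close>
  define q where "q = poi_fail (b + 2) (c * x) 0"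
  have q: "q < 1" unfolding q_def using c x by (intro poi_fail_less_1) auto
  define z where "z = (1 - q) / 2"
  have z: "z > 0" "z + q < 1" using q by (auto simp: z_def field_simps)
  define s where "s = 3 * ((b + 2) ^ (L + 1) * (b + 3) + 1)"
  have "s \<ge> 1" by (simp add: s_def)
  then obtain \<epsilon> where \<epsilon>: "\<epsilon> > 0"
    and sp: "(\<lambda>n. measure_pmf.prob (gnp n (c / real n))
     {F. \<exists>S\<subseteq>{1..n}. real (card S) \<le> \<epsilon> * real n \<and> (s + 1) * card S < s * edges_in F S}) \<longlonglongrightarrow> 0"
    using gnp_sparse[OF c] by blast
  obtain D :: nat where "max (4 * real (s + 2) / \<epsilon>) (real (s + 2) / z) < real D"
    using reals_Archimedean2 by blast
  then have D: "4 * real (s + 2) \<le> \<epsilon> * real D" "real (s + 2) < z * real D"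
    using \<epsilon> z by (auto simp: pos_divide_less_eq mult.commute less_imp_le)
  then have D0: "D > 0" by (cases D) auto
  let ?h = "D * (L + 2)"
  define root where "root F W v \<longleftrightarrow> sat (b + 2) {u \<in> W - {v}. good F (b + 1) L ?h L u (W - {v})}
           {u \<in> W - {v}. (0::nat) > 0 \<and> good F (b + 1) L ?h (0 - 1) u (W - {v})} (nbrs F v)"
    for F :: "nat set set" and W v
  have "abundant c (min x ((real L + 1) * \<delta>)) (\<lambda>F W v. good F (b + 1) L ?h L v W)"
    by (rule abundant_good[OF c x \<delta> ineq L]) auto
  then have "abundant c x (\<lambda>F W v. good F (b + 1) L ?h L v W)" using L by (simp add: min_absorb1)
  then have root: "abundant c z root" unfolding root_def
    by (intro abundant_step[where x=x and y=0]) (use c x z in \<open>auto simp: q_def\<close>)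
  have ab: "\<forall>\<^sub>F n in sequentially. measure_pmf.prob (gnp n (c / real n))
      {F. real (card {v \<in> {1..n}. root F {1..n} v}) < z * real n} \<le> \<tau>" if "\<tau> > 0" for \<tau>
    \<comment> \<open>With \<open>C = 0\<close> the only admissible \<open>W\<close> is the whole
      vertex set.\<close>
    using that[THEN root[unfolded abundant_def, THEN spec[of _ 0], THEN spec, THEN mp]]
  proof (rule eventually_mono)
    fix n
    assume *: "\<forall>W\<subseteq>{1..n}. n \<le> card W + 0 \<longrightarrow> measure_pmf.prob (gnp n (c / real n))
      {F. real (card {v \<in> W. root F W v}) < z * real n} \<le> \<tau>"
    show "measure_pmf.prob (gnp n (c / real n))
      {F. real (card {v \<in> {1..n}. root F {1..n} v}) < z * real n} \<le> \<tau>"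
      by (rule *[rule_format, OF order_refl]) simp
  qed
  have ro: "(\<lambda>n. measure_pmf.prob (gnp n (c / real n))
      {F. real (card {v \<in> {1..n}. root F {1..n} v}) < z * real n}) \<longlonglongrightarrow> 0"
  proof (rule order_tendstoI)
    fix e :: real assume "e > 0"
    then show "\<forall>\<^sub>F n in sequentially. measure_pmf.prob (gnp n (c / real n))
      {F. real (card {v \<in> {1..n}. root F {1..n} v}) < z * real n} < e"
      using ab[of "e / 2"] by (auto elim!: eventually_mono)
  qed (auto intro!: always_eventually order.strict_trans2[OF _ measure_nonneg])
  have "(\<lambda>n. measure_pmf.prob (gnp n (c / real n))
           {E. real (s_star b first {1..n} E) \<ge> \<epsilon> / 2 * real n}) \<longlonglongrightarrow> 1" for first
  proof (rule tendsto_sandwich)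
    let ?X = "\<lambda>n. {F. \<exists>S\<subseteq>{1..n}. real (card S) \<le> \<epsilon> * real n \<and> (s + 1) * card S < s * edges_in F S}"
    let ?Y = "\<lambda>n. {F. real (card {v \<in> {1..n}. root F {1..n} v}) < z * real n}"
    let ?G = "\<lambda>n. {E. real (s_star b first {1..n} E) \<ge> \<epsilon> / 2 * real n}"
    let ?pr = "\<lambda>n. measure_pmf.prob (gnp n (c / real n))"
    show "\<forall>\<^sub>F n in sequentially. 1 - (?pr n (?X n) + ?pr n (?Y n)) \<le> ?pr n (?G n)"
      using eventually_ge_at_top[of "nat \<lceil>4 / \<epsilon>\<rceil>"]
    proof eventually_elim
      case (elim n)
      then have "4 / \<epsilon> \<le> real n" by linarith
      then have n: "4 \<le> \<epsilon> * real n" using \<epsilon> by (simp add: pos_divide_le_eq mult.commute)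
      have "?pr n (- ?G n) \<le> ?pr n (?X n \<union> ?Y n)" unfolding gnp_rand_subset
      proof (rule prob_rand_subset_mono)
        fix F assume F: "F \<in> - ?G n" "F \<subseteq> all_edges {1..n}"
        show "F \<in> ?X n \<union> ?Y n"
        proof (rule ccontr)
          assume neg: "F \<notin> ?X n \<union> ?Y n"
          have "\<epsilon> / 2 * real (card {1..n}) \<le> real (s_star b first {1..n} F)"
          proof (rule s_star_linear[OF _ F(2) assms(1) \<epsilon> s_def _ D0 D])
            show "s * edges_in F S \<le> (s + 1) * card S"
              if "S \<subseteq> {1..n}" "real (card S) \<le> \<epsilon> * real (card {1..n})" for S
              using neg that by (auto simp: not_less)
            have "root F {1..n} r \<longleftrightarrow> b + 3 \<le>
                card (nbrs F r \<inter> {u \<in> {1..n} - {r}. good F (b + 1) L ?h L u ({1..n} - {r})})" for r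
              by (auto simp: root_def sat_def)
            then show "z * real (card {1..n}) \<le> real (card {r \<in> {1..n}. b + 3 \<le>
                card (nbrs F r \<inter> {u \<in> {1..n} - {r}. good F (b + 1) L ?h L u ({1..n} - {r})})})"
              using neg by (simp add: not_less)
          qed (use n in auto)
          then show False using F(1) by simp
        qed
      qed
      also have "\<dots> \<le> ?pr n (?X n) + ?pr n (?Y n)" by (rule measure_Un_le) auto
      finally show ?case using measure_pmf.prob_compl[of "?G n" "gnp n (c / real n)"]
        by (simp add: Compl_eq_Diff_UNIV)
    qed
    show "(\<lambda>n. 1 - (?pr n (?X n) + ?pr n (?Y n))) \<longlonglongrightarrow> 1"
      using tendsto_diff[OF tendsto_const[of 1] tendsto_add[OF sp ro]] by simp
  qed auto
  then show ?thesis using \<epsilon> by (intro exI[of _ "\<epsilon> / 2"]) auto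
qed

end
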